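(* Let $O$ be an origami, let $\Gamma(O)\subseteq\mathrm{SL}_2(\mathbb{Z})$ be its Veech group and let $\bar\Gamma(O)$ be the image of $\Gamma(O)$ in $\mathrm{PSL}_2(\mathbb{Z})$. Consider the procedure described in the context, applied to $O$, producing lists $\mathbf{Rep}$ and $\mathbf{Gen}$ of elements of $\mathrm{PSL}_2(\mathbb{Z})$. Then: 1. Any two (distinct) entries of $\mathbf{Rep}$ belong to different right cosets of $\bar\Gamma(O)$ in $\mathrm{PSL}_2(\mathbb{Z})$. 2. The procedure stops after finitely many steps. 3. In the end each right coset $\bar\Gamma(O)\cdot\bar A$, $\bar A\in\mathrm{PSL}_2(\mathbb{Z})$, is represented by a member of $\mathbf{Rep}$. 4. In the end $\bar\Gamma(O)$ is generated by the elements of $\mathbf{Gen}$.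
   Context: Translation surfaces and origamis. A translation structure on a surface is an atlas all of whose transition maps are translations. For a translation surface $Y$, $\mathrm{Aff}^+(Y)$ is the group of orientation preserving affine diffeomorphisms of $Y$ (in charts $z\mapsto Az+b$), $\mathrm{der}:\mathrm{Aff}^+(Y)\to\mathrm{GL}_2(\mathbb{R})$ sends such a map to its linear part $A$, and $\Gamma(Y):=\mathrm{der}(\mathrm{Aff}^+(Y))$ is the Veech group. Let $E^\star$ be the torus $\mathbb{C}/\mathbb{Z}^2$ with the image of $0$ removed, with the translation structure induced from $\mathbb{C}$. An origami $O$ is an unramified covering $p:X\to E^\star$ of finite degree, with $X$ connected (and obtained from a compact surface by removing finitely many points). $X$ carries the translation structure lifted via $p$, and $\Gamma(O):=\Gamma(X)$, which is a subgroup of $\mathrm{SL}_2(\mathbb{Z})$. Notation. $S=\begin{pmatrix}0&-1\\1&0\end{pmatrix}$, $T=\begin{pmatrix}1&1\\0&1\end{pmatrix}$. For $A\in\mathrm{SL}_2(\mathbb{Z})$, $\bar A$ is its image in $\mathrm{PSL}_2(\mathbb{Z})$; for an element $\bar A$ of $\mathrm{PSL}_2(\mathbb{Z})$, $A$ denotes some lift. $I$ is the identity matrix. The right cosets of $\bar\Gamma(O)$ are the sets $\bar\Gamma(O)\cdot\bar A$. The procedure. Start with empty ordered lists $\mathbf{Rep}$ and $\mathbf{Gen}$. Add $\bar I$ to $\mathbf{Rep}$ and put $\bar A:=\bar I$. Loop: Put $B:=A\cdot T$ and $C:=A\cdot S$. For each $\bar D$ in $\mathbf{Rep}$ check whether $B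 D^{-1}\in\Gamma(O)$ or $-BD^{-1}\in\Gamma(O)$; if so, add $\bar B\bar D^{-1}$ to $\mathbf{Gen}$. If no such $\bar D$ is found, append $\bar B$ to $\mathbf{Rep}$. Then do the same for $C$ instead of $B$ (with the updated list $\mathbf{Rep}$). If there is a successor of $\bar A$ in the list $\mathbf{Rep}$ (the next entry after $\bar A$), let $\bar A$ now be this successor and go back to the beginning of the loop; if not, stop. *)

theory Defs
  imports "HOL-Analysis.Analysis" "HOL-Algebra.Generated_Groups"
begin

section \<open>Translation surfaces and their Veech groups\<close>

text \<open>
  The plane \<open>\<complex>\<close> is identified with \<open>real^2\<close>.  An atlas on \<open>Y\<close> is a set of charts \<open>(U, \<phi>)\<close>; the
  values of \<open>\<phi>\<close> outside \<open>U\<close> are irrelevant.  Transition maps of a translation structure are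
  translations locally, that is on each connected component of the overlap.
\<close>

type_synonym 'a atlas = "('a set \<times> ('a \<Rightarrow> real^2)) set"

definition translation_structure :: "'a::topological_space set \<Rightarrow> 'a atlas \<Rightarrow> bool" where
  "translation_structure Y \<A> \<longleftrightarrow>
     (\<Union>(U, \<phi>)\<in>\<A>. U) = Y \<and>
     (\<forall>(U, \<phi>)\<in>\<A>. openin (top_of_set Y) U \<and> open (\<phi> ` U) \<and> (\<exists>\<phi>'. homeomorphism U (\<phi> ` U) \<phi> \<phi>')) \<and>
     (\<forall>(U, \<phi>)\<in>\<A>. \<forall>(V, \<psi>)\<in>\<A>. \<forall>x\<in>U \<inter> V. \<exists>W b. openin (top_of_set Y) W \<and> x \<in> W \<and>
        W \<subseteq> U \<inter> V \<and> (\<forall>y\<in>W. \<psi> y = \<phi> y + b))"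

text \<open>
  \<open>affine_with Y \<A> A f\<close>: the homeomorphism \<open>f\<close> of \<open>Y\<close> reads \<open>z \<mapsto> A z + b\<close> in charts, with \<open>b\<close>
  depending on the charts and on the component.  If \<open>A\<close> is invertible, such an \<open>f\<close> is
  automatically a diffeomorphism; it preserves the orientation iff \<open>det A > 0\<close>.
\<close>

definition affine_with ::
  "'a::topological_space set \<Rightarrow> 'a atlas \<Rightarrow> real^2^2 \<Rightarrow> ('a \<Rightarrow> 'a) \<Rightarrow> bool" where
  "affine_with Y \<A> A f \<longleftrightarrow>
     (\<exists>g. homeomorphism Y Y f g) \<and>
     (\<forall>(U, \<phi>)\<in>\<A>. \<forall>(V, \<psi>)\<in>\<A>. \<forall>x\<in>U. f x \<in> V \<longrightarrow>
        (\<exists>W b. openin (top_of_set Y) W \<and> x \<in> W \<and> W \<subseteq> U \<and> f ` W \<subseteq> V \<and>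
           (\<forall>y\<in>W. \<psi> (f y) = A *v \<phi> y + b)))"

definition Aff_plus :: "'a::topological_space set \<Rightarrow> 'a atlas \<Rightarrow> ('a \<Rightarrow> 'a) set" where
  "Aff_plus Y \<A> = {f. \<exists>A. affine_with Y \<A> A f \<and> det A > 0}"

definition der :: "'a::topological_space set \<Rightarrow> 'a atlas \<Rightarrow> ('a \<Rightarrow> 'a) \<Rightarrow> real^2^2" where
  "der Y \<A> f = (THE A. affine_with Y \<A> A f)"

definition Veech_group :: "'a::topological_space set \<Rightarrow> 'a atlas \<Rightarrow> (real^2^2) set" where
  "Veech_group Y \<A> = der Y \<A> ` Aff_plus Y \<A>"

definition lifted_atlas ::
  "'a::topological_space set \<Rightarrow> ('a \<Rightarrow> 'b) \<Rightarrow> 'b::topological_space set \<Rightarrow> 'b atlas \<Rightarrow> 'a atlas" where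
  "lifted_atlas X p Y \<A> =
     {(U, \<phi> \<circ> p) | U V \<phi>. (V, \<phi>) \<in> \<A> \<and> openin (top_of_set X) U \<and> openin (top_of_set Y) (p ` U) \<and>
        p ` U \<subseteq> V \<and> (\<exists>q. homeomorphism U (p ` U) p q)}"

lemma translation_structure_lifted_atlas:
  fixes p :: "'a::topological_space \<Rightarrow> 'b::topological_space"
  assumes cov: "covering_space X p Y" and Y: "translation_structure Y \<A>"
  shows "translation_structure X (lifted_atlas X p Y \<A>)"
proof -
  have p: "continuous_on X p" "p ` X = Y"
    using cov by (auto simp: covering_space_def)
  have chart: "openin (top_of_set Y) V" "open (\<phi> ` V)" "\<exists>\<phi>'. homeomorphism V (\<phi> ` V) \<phi> \<phi>'"
    if "(V, \<phi>) \<in> \<A>" for V \<phi>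
    using Y that unfolding translation_structure_def by blast+
  have union: "(\<Union>(U, \<phi>)\<in>\<A>. U) = Y"
    using Y unfolding translation_structure_def by blast
  have trans: "\<exists>W b. openin (top_of_set Y) W \<and> x \<in> W \<and> W \<subseteq> U \<inter> V \<and> (\<forall>y\<in>W. \<psi> y = \<phi> y + b)"
    if "(U, \<phi>) \<in> \<A>" "(V, \<psi>) \<in> \<A>" "x \<in> U \<inter> V" for U \<phi> V \<psi> x
    using Y that unfolding translation_structure_def by blast
  show ?thesis
    unfolding translation_structure_def
  proof (intro conjI)
    show "(\<Union>(U, \<phi>)\<in>lifted_atlas X p Y \<A>. U) = X"
    proof (intro equalityI subsetI)
      fix x assume "x \<in> X"
      then have "p x \<in> Y"
        using p by auto
      obtain V \<phi> where V: "(V, \<phi>) \<in> \<A>" "p x \<in> V"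
        using union \<open>p x \<in> Y\<close> by blast
      obtain T v where T: "p x \<in> T" "openin (top_of_set Y) T" "\<Union>v = X \<inter> p -` T"
        "\<forall>u\<in>v. openin (top_of_set X) u" "\<forall>u\<in>v. \<exists>q. homeomorphism u T p q"
        using cov \<open>p x \<in> Y\<close> unfolding covering_space_def by meson
      obtain u where u: "u \<in> v" "x \<in> u"
        using T(1,3) \<open>x \<in> X\<close> by blast
      then obtain q where q: "homeomorphism u T p q"
        using T(5) by blast
      define U where "U = u \<inter> p -` V"
      have pU: "p ` U = T \<inter> V"
        using q by (auto simp: U_def homeomorphism_def)
      have "openin (top_of_set X) (X \<inter> p -` V)"
        using continuous_openin_preimage[OF p(1) _ chart(1)[OF V(1)]] p(2) by auto
      then have "openin (top_of_set X) (u \<inter> (X \<inter> p -` V))"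
        using T(4) u(1) openin_Int by blast
      moreover have "u \<inter> (X \<inter> p -` V) = U"
        using T(3) u by (auto simp: U_def)
      ultimately have "openin (top_of_set X) U"
        by simp
      moreover have "openin (top_of_set Y) (p ` U)"
        unfolding pU using T(2) chart(1)[OF V(1)] by (rule openin_Int)
      moreover have "homeomorphism U (p ` U) p q"
        by (rule homeomorphism_of_subsets[OF q]) (auto simp: U_def)
      ultimately have "(U, \<phi> \<circ> p) \<in> lifted_atlas X p Y \<A>"
        unfolding lifted_atlas_def using V(1) pU by blast
      moreover have "x \<in> U"
        using u V(2) by (simp add: U_def)
      ultimately show "x \<in> (\<Union>(U, \<phi>)\<in>lifted_atlas X p Y \<A>. U)"
        by blast
    next
      fix x assume "x \<in> (\<Union>(U, \<phi>)\<in>lifted_atlas X p Y \<A>. U)"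
      then show "x \<in> X"
        unfolding lifted_atlas_def by (auto dest: openin_imp_subset)
    qed
    show "\<forall>(U, \<phi>)\<in>lifted_atlas X p Y \<A>. openin (top_of_set X) U \<and> open (\<phi> ` U) \<and>
        (\<exists>\<phi>'. homeomorphism U (\<phi> ` U) \<phi> \<phi>')"
    proof clarify
      fix U \<eta> assume "(U, \<eta>) \<in> lifted_atlas X p Y \<A>"
      then obtain V \<phi> q where U: "\<eta> = \<phi> \<circ> p" "(V, \<phi>) \<in> \<A>" "openin (top_of_set X) U"
        "openin (top_of_set Y) (p ` U)" "p ` U \<subseteq> V" "homeomorphism U (p ` U) p q"
        unfolding lifted_atlas_def by blast
      obtain \<phi>' where h: "homeomorphism V (\<phi> ` V) \<phi> \<phi>'"
        using chart(3)[OF U(2)] by blast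
      have "openin (top_of_set V) (p ` U)"
        using openin_subset_trans[OF U(4,5) openin_imp_subset[OF chart(1)[OF U(2)]]] .
      then have "openin (top_of_set (\<phi> ` V)) (\<phi> ` (p ` U))"
        using homeomorphism_imp_open_map[OF h] by blast
      then have "open (\<phi> ` (p ` U))"
        using openin_open_eq[OF chart(2)[OF U(2)]] by blast
      moreover have "homeomorphism (p ` U) (\<phi> ` (p ` U)) \<phi> \<phi>'"
        by (rule homeomorphism_of_subsets[OF h]) (use U(5) in auto)
      then have "homeomorphism U (\<phi> ` (p ` U)) (\<phi> \<circ> p) (q \<circ> \<phi>')"
        using homeomorphism_compose[OF U(6)] by blast
      ultimately show "openin (top_of_set X) U \<and> open (\<eta> ` U) \<and>
          (\<exists>\<phi>'. homeomorphism U (\<eta> ` U) \<eta> \<phi>')"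
        unfolding U(1) image_comp[symmetric] using U(3) by blast
    qed
    show "\<forall>(U, \<phi>)\<in>lifted_atlas X p Y \<A>. \<forall>(V, \<psi>)\<in>lifted_atlas X p Y \<A>. \<forall>x\<in>U \<inter> V. \<exists>W b.
        openin (top_of_set X) W \<and> x \<in> W \<and> W \<subseteq> U \<inter> V \<and> (\<forall>y\<in>W. \<psi> y = \<phi> y + b)"
    proof (clarify, goal_cases)
      case (1 U \<phi> V \<psi> x)
      obtain U' \<phi>' where U: "\<phi> = \<phi>' \<circ> p" "(U', \<phi>') \<in> \<A>" "openin (top_of_set X) U" "p ` U \<subseteq> U'"
        using 1(1) unfolding lifted_atlas_def by blast
      obtain V' \<psi>' where V: "\<psi> = \<psi>' \<circ> p" "(V', \<psi>') \<in> \<A>" "openin (top_of_set X) V" "p ` V \<subseteq> V'"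
        using 1(2) unfolding lifted_atlas_def by blast
      have "p x \<in> U' \<inter> V'"
        using U(4) V(4) 1(3,4) by blast
      then obtain W b where W: "openin (top_of_set Y) W" "p x \<in> W" "\<forall>y\<in>W. \<psi>' y = \<phi>' y + b"
        using trans[OF U(2) V(2)] by blast
      have "openin (top_of_set X) (X \<inter> p -` W)"
        using continuous_openin_preimage[OF p(1) _ W(1)] p(2) by auto
      then have "openin (top_of_set X) (U \<inter> V \<inter> (X \<inter> p -` W))"
        using openin_Int[OF openin_Int[OF U(3) V(3)]] by simp
      moreover have "x \<in> U \<inter> V \<inter> (X \<inter> p -` W)"
        using 1(3,4) W(2) openin_imp_subset[OF U(3)] by blast
      moreover have "\<forall>y\<in>U \<inter> V \<inter> (X \<inter> p -` W). \<psi> y = \<phi> y + b"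
        using W(3) U(1) V(1) by simp
      ultimately show ?case
        by (intro exI[of _ "U \<inter> V \<inter> (X \<inter> p -` W)"] exI[of _ b]) blast
    qed
  qed
qed


section \<open>Origamis\<close>

quotient_type torus = "real^2" / "\<lambda>v w :: real^2. \<forall>i. v $ i - w $ i \<in> \<int>"
  morphisms rep_torus torus_proj
proof (rule equivpI)
  show "reflp (\<lambda>v w :: real^2. \<forall>i. v $ i - w $ i \<in> \<int>)"
    by (simp add: reflp_def)
  show "symp (\<lambda>v w :: real^2. \<forall>i. v $ i - w $ i \<in> \<int>)"
  proof (rule sympI, rule allI)
    fix v w :: "real^2" and i
    assume "\<forall>i. v $ i - w $ i \<in> \<int>"
    then have "- (v $ i - w $ i) \<in> \<int>"
      by (intro Ints_minus) auto
    then show "w $ i - v $ i \<in> \<int>"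
      by simp
  qed
  show "transp (\<lambda>v w :: real^2. \<forall>i. v $ i - w $ i \<in> \<int>)"
  proof (rule transpI, rule allI)
    fix u v w :: "real^2" and i
    assume "\<forall>i. u $ i - v $ i \<in> \<int>" "\<forall>i. v $ i - w $ i \<in> \<int>"
    then have "(u $ i - v $ i) + (v $ i - w $ i) \<in> \<int>"
      by (intro Ints_add) auto
    then show "u $ i - w $ i \<in> \<int>"
      by simp
  qed
qed

instantiation torus :: topological_space
begin

definition open_torus :: "torus set \<Rightarrow> bool" where
  "open_torus U \<longleftrightarrow> open (torus_proj -` U)"

instance
  by standard (auto simp: open_torus_def vimage_Union)

end

definition Estar :: "torus set" where
  "Estar = - {torus_proj 0}"

text \<open>The charts induced from the plane are the local inverses of the projection.\<close>

definition Estar_atlas :: "torus atlas" where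
  "Estar_atlas =
     {(torus_proj ` V, \<phi>) | V \<phi>. open V \<and> torus_proj ` V \<subseteq> Estar \<and> (\<forall>v\<in>V. \<phi> (torus_proj v) = v)}"

lemma torus_proj_eq_iff: "torus_proj v = torus_proj w \<longleftrightarrow> (\<forall>i. v $ i - w $ i \<in> \<int>)"
  by (rule torus.abs_eq_iff)

lemma torus_proj_surj: "\<exists>v. torus_proj v = y"
  by (rule torus.abs_induct[of _ y]) auto

lemma Ints_eq_if_abs_diff_less_1: "a = b" if "a - b \<in> \<int>" "\<bar>a - b\<bar> < 1" for a b :: real
  using Ints_nonzero_abs_less1[OF that] by simp

lemma continuous_on_torus_proj: "continuous_on UNIV torus_proj"
  unfolding continuous_on_open_vimage[OF open_UNIV] by (simp add: open_torus_def)

lemma open_torus_proj_image: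
  assumes "open V"
  shows "open (torus_proj ` V)"
proof -
  have "torus_proj -` (torus_proj ` V) = (\<Union>k\<in>{k. \<forall>i. k $ i \<in> \<int>}. (\<lambda>v. k + v) ` V)"
  proof (intro equalityI subsetI)
    fix v assume "v \<in> torus_proj -` (torus_proj ` V)"
    then obtain w where "w \<in> V" "torus_proj v = torus_proj w"
      by auto
    then show "v \<in> (\<Union>k\<in>{k. \<forall>i. k $ i \<in> \<int>}. (\<lambda>v. k + v) ` V)"
      by (intro UN_I[of "v - w"]) (auto simp: torus_proj_eq_iff image_iff intro!: bexI[of _ w])
  next
    fix v assume "v \<in> (\<Union>k\<in>{k. \<forall>i. k $ i \<in> \<int>}. (\<lambda>v. k + v) ` V)"
    then obtain k w where k: "\<forall>i. k $ i \<in> \<int>" "w \<in> V" "v = k + w"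
      by blast
    then have "torus_proj v = torus_proj w"
      by (simp add: torus_proj_eq_iff)
    with k(2) show "v \<in> torus_proj -` (torus_proj ` V)"
      by simp
  qed
  then show ?thesis
    using assms by (auto simp: open_torus_def intro!: open_translation)
qed

lemma open_Estar: "open Estar"
proof -
  have "torus_proj -` Estar = (\<Union>i. (\<lambda>v. v $ i) -` (- \<int>))"
    by (auto simp: Estar_def torus_proj_eq_iff)
  moreover have "open ((\<lambda>v::real^2. v $ i) -` (- \<int>))" for i
    by (intro open_vimage open_Compl closed_Ints continuous_intros)
  ultimately show ?thesis
    by (auto simp: open_torus_def)
qed

lemma Estar_chart_homeomorphism:
  assumes "open V" "\<And>v. v \<in> V \<Longrightarrow> \<phi> (torus_proj v) = v"
  shows "homeomorphism (torus_proj ` V) V \<phi> torus_proj"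
proof (rule homeomorphismI)
  show "continuous_on (torus_proj ` V) \<phi>"
    unfolding continuous_on_open_invariant
  proof (intro allI impI)
    fix B :: "(real^2) set" assume "open B"
    then have "open (torus_proj ` (V \<inter> B))"
      by (intro open_torus_proj_image open_Int assms)
    moreover have "torus_proj ` (V \<inter> B) \<inter> torus_proj ` V = \<phi> -` B \<inter> torus_proj ` V"
      using assms(2) by auto
    ultimately show "\<exists>A. open A \<and> A \<inter> torus_proj ` V = \<phi> -` B \<inter> torus_proj ` V"
      by blast
  qed
  show "continuous_on V torus_proj"
    using continuous_on_torus_proj continuous_on_subset by blast
qed (use assms(2) in auto)

lemma translation_structure_Estar: "translation_structure Estar Estar_atlas"
  unfolding translation_structure_def
proof (intro conjI)
  show "(\<Union>(U, \<phi>)\<in>Estar_atlas. U) = Estar"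
  proof (intro equalityI subsetI)
    fix y assume "y \<in> Estar"
    obtain v where v: "torus_proj v = y"
      using torus_proj_surj by blast
    obtain e where e: "e > 0" "ball v e \<subseteq> torus_proj -` Estar"
      using open_Estar \<open>y \<in> Estar\<close> v unfolding open_torus_def open_contains_ball by blast
    define V where "V = ball v (min e (1/2))"
    have "inj_on torus_proj V"
    proof (rule inj_onI)
      fix u w assume uw: "u \<in> V" "w \<in> V" "torus_proj u = torus_proj w"
      have "dist u w < 1"
        using uw(1,2) dist_triangle_half_r[of v u 1 w] by (simp add: V_def dist_commute)
      then have "\<bar>u $ i - w $ i\<bar> < 1" for i
        using dist_vec_nth_le[of u i w] by (simp add: dist_real_def)
      then show "u = w"
        using uw(3) by (auto simp: vec_eq_iff torus_proj_eq_iff intro: Ints_eq_if_abs_diff_less_1)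
    qed
    then have "(torus_proj ` V, the_inv_into V torus_proj) \<in> Estar_atlas"
      using e unfolding Estar_atlas_def
      by (intro CollectI exI[of _ V] exI[of _ "the_inv_into V torus_proj"])
         (auto simp: V_def the_inv_into_f_f)
    moreover have "y \<in> torus_proj ` V"
      using v e by (auto simp: V_def)
    ultimately show "y \<in> (\<Union>(U, \<phi>)\<in>Estar_atlas. U)"
      by blast
  qed (auto simp: Estar_atlas_def)
  have *: "\<exists>V. open V \<and> U = torus_proj ` V \<and> V = \<phi> ` U \<and> U \<subseteq> Estar \<and> homeomorphism U V \<phi> torus_proj"
    if U: "(U, \<phi>) \<in> Estar_atlas" for U \<phi>
  proof -
    obtain V where V: "open V" "U = torus_proj ` V" "U \<subseteq> Estar" "\<And>v. v \<in> V \<Longrightarrow> \<phi> (torus_proj v) = v"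
      using U unfolding Estar_atlas_def by blast
    have "homeomorphism U V \<phi> torus_proj"
      using Estar_chart_homeomorphism[OF V(1,4)] V(2) by simp
    moreover from this have "V = \<phi> ` U"
      by (simp add: homeomorphism_def)
    ultimately show ?thesis
      using V(1-3) by (intro exI[of _ V] conjI)
  qed
  show "\<forall>(U, \<phi>)\<in>Estar_atlas. openin (top_of_set Estar) U \<and> open (\<phi> ` U) \<and>
      (\<exists>\<phi>'. homeomorphism U (\<phi> ` U) \<phi> \<phi>')"
  proof clarify
    fix U \<phi> assume "(U, \<phi>) \<in> Estar_atlas"
    from *[OF this] obtain V where V: "open V" "U = torus_proj ` V" "V = \<phi> ` U" "U \<subseteq> Estar"
      "homeomorphism U V \<phi> torus_proj"
      by blast
    have "openin (top_of_set Estar) U"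
      unfolding openin_open_eq[OF open_Estar] using open_torus_proj_image[OF V(1)] V(2,4) by simp
    with V(1,3,5) show "openin (top_of_set Estar) U \<and> open (\<phi> ` U) \<and> (\<exists>\<phi>'. homeomorphism U (\<phi> ` U) \<phi> \<phi>')"
      by metis
  qed
  show "\<forall>(U, \<phi>)\<in>Estar_atlas. \<forall>(V, \<psi>)\<in>Estar_atlas. \<forall>x\<in>U \<inter> V. \<exists>W b.
      openin (top_of_set Estar) W \<and> x \<in> W \<and> W \<subseteq> U \<inter> V \<and> (\<forall>y\<in>W. \<psi> y = \<phi> y + b)"
  proof (clarify, goal_cases)
    case (1 U \<phi> V \<psi> x)
    from *[OF 1(1)] obtain U' where U: "open U'" "U = torus_proj ` U'" "U \<subseteq> Estar"
      "homeomorphism U U' \<phi> torus_proj"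
      by blast
    from *[OF 1(2)] obtain V' where V: "open V'" "V = torus_proj ` V'" "V \<subseteq> Estar"
      "homeomorphism V V' \<psi> torus_proj"
      by blast
    define g where "g y = \<psi> y - \<phi> y" for y
    have op: "open (U \<inter> V)"
      using U V by (simp add: open_torus_proj_image open_Int)
    have cont: "continuous_on (U \<inter> V) g"
      using U(4) V(4) unfolding g_def homeomorphism_def
      by (intro continuous_on_diff) (auto intro: continuous_on_subset)
    define W where "W = (U \<inter> V) \<inter> g -` ball (g x) 1"
    have "open W"
      unfolding W_def using cont op by (intro continuous_open_preimage) auto
    have int: "g y $ i \<in> \<int>" if "y \<in> U \<inter> V" for y i
    proof -
      have "torus_proj (\<psi> y) = torus_proj (\<phi> y)"
        using U(4) V(4) that by (auto simp: homeomorphism_def)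
      then show ?thesis
        by (simp add: g_def torus_proj_eq_iff)
    qed
    have "g y = g x" if "y \<in> W" for y
    proof -
      have "\<bar>g y $ i - g x $ i\<bar> < 1" for i
        using that dist_vec_nth_le[of "g y" i "g x"]
        by (simp add: W_def dist_real_def dist_commute)
      moreover have "g y $ i - g x $ i \<in> \<int>" for i
        using int 1 that by (intro Ints_diff) (auto simp: W_def)
      ultimately show ?thesis
        by (auto simp: vec_eq_iff intro: Ints_eq_if_abs_diff_less_1)
    qed
    then have "\<forall>y\<in>W. \<psi> y = \<phi> y + g x"
      unfolding g_def by (metis add.commute diff_add_cancel)
    moreover have "x \<in> W" "W \<subseteq> U \<inter> V"
      using 1 by (auto simp: W_def)
    moreover have "openin (top_of_set Estar) W"
      using \<open>open W\<close> \<open>W \<subseteq> U \<inter> V\<close> U(3) by (simp add: openin_open_eq open_Estar le_infI1 subset_iff)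
    ultimately show ?case
      by blast
  qed
qed

text \<open>
  The total space of such a covering is automatically a compact surface with finitely many points
  removed.
\<close>

definition origami :: "'a::topological_space set \<Rightarrow> ('a \<Rightarrow> torus) \<Rightarrow> bool" where
  "origami X p \<longleftrightarrow>
     connected X \<and> covering_space X p Estar \<and> (\<forall>y\<in>Estar. finite {x \<in> X. p x = y})"

definition origami_Veech_group ::
  "'a::topological_space set \<Rightarrow> ('a \<Rightarrow> torus) \<Rightarrow> (real^2^2) set" where
  "origami_Veech_group X p = Veech_group X (lifted_atlas X p Estar Estar_atlas)"


section \<open>The modular group\<close>

definition SL2Z :: "(int^2^2) monoid" where
  "SL2Z = \<lparr>carrier = {A. det A = 1}, mult = (**), one = mat 1\<rparr>"

definition PSL2Z :: "(int^2^2) set monoid" where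
  "PSL2Z = SL2Z Mod {mat 1, - mat 1}"

definition PSL_class :: "int^2^2 \<Rightarrow> (int^2^2) set" where
  "PSL_class A = {mat 1, - mat 1} #>\<^bsub>SL2Z\<^esub> A"

lemma group_SL2Z: "group SL2Z"
proof (rule groupI)
  fix x assume "x \<in> carrier SL2Z"
  then have d: "det x = 1" by (simp add: SL2Z_def)
  let ?y = "vector [vector [x$2$2, - (x$1$2)], vector [-(x$2$1), x$1$1]] :: int^2^2"
  have "det ?y = 1" using d by (simp add: det_2 algebra_simps)
  moreover have "?y ** x = mat 1" using d
    by (simp add: det_2 vec_eq_iff matrix_matrix_mult_def forall_2 sum_2 mat_def algebra_simps)
  ultimately show "\<exists>y\<in>carrier SL2Z. y \<otimes>\<^bsub>SL2Z\<^esub> x = \<one>\<^bsub>SL2Z\<^esub>"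
    unfolding SL2Z_def by (auto intro!: exI[of _ ?y])
qed (auto simp: SL2Z_def det_mul matrix_mul_assoc)

lemma normal_SL2Z: "{mat 1, - mat 1} \<lhd> SL2Z"
proof -
  have mm: "- A ** B = - (A ** B)" "A ** - B = - (A ** B)" for A B :: "int^2^2"
    by (auto simp: vec_eq_iff matrix_matrix_mult_def sum_negf)
  have d: "det (- mat 1 :: int^2^2) = 1"
    by (simp add: det_2 mat_def)
  interpret group SL2Z by (rule group_SL2Z)
  have inv: "inv\<^bsub>SL2Z\<^esub> (- mat 1) = - mat 1" "inv\<^bsub>SL2Z\<^esub> (mat 1) = mat 1"
    by (rule inv_equality; simp add: SL2Z_def d mm)+
  have "subgroup {mat 1, - mat 1} SL2Z"
    by (rule subgroupI) (use inv d in \<open>auto simp: mm SL2Z_def\<close>)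
  then show ?thesis
    unfolding normal_def normal_axioms_def using group_SL2Z
    by (auto simp: r_coset_def l_coset_def SL2Z_def mm)
qed

lemma group_PSL2Z: "group PSL2Z"
  unfolding PSL2Z_def by (rule normal.factorgroup_is_group[OF normal_SL2Z])

lemma PSL_class_eq: "PSL_class A = {A, -A}"
proof -
  have mm: "- A ** B = - (A ** B)" for A B :: "int^2^2"
    by (auto simp: vec_eq_iff matrix_matrix_mult_def sum_negf)
  show ?thesis by (auto simp: PSL_class_def r_coset_def SL2Z_def mm)
qed

definition S_mat :: "int^2^2" where
  "S_mat = vector [vector [0, -1], vector [1, 0]]"

definition T_mat :: "int^2^2" where
  "T_mat = vector [vector [1, 1], vector [0, 1]]"

text \<open>
  The Veech group of an origami consists of integral matrices of determinant 1; the following is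
  this group, with entries regarded as integers, and its image in \<open>PSL2Z\<close>.
\<close>

definition Gamma_O :: "'a::topological_space set \<Rightarrow> ('a \<Rightarrow> torus) \<Rightarrow> (int^2^2) set" where
  "Gamma_O X p = {A \<in> carrier SL2Z. map_matrix real_of_int A \<in> origami_Veech_group X p}"

definition Gamma_O_bar :: "'a::topological_space set \<Rightarrow> ('a \<Rightarrow> torus) \<Rightarrow> (int^2^2) set set" where
  "Gamma_O_bar X p = PSL_class ` Gamma_O X p"


section \<open>The procedure\<close>

text \<open>
  A state \<open>(Rep, Gen, i)\<close> records the two lists and the position \<open>i\<close> in \<open>Rep\<close> of the element to be
  treated next; there is none, and the procedure has stopped, once \<open>i\<close> equals the length of \<open>Rep\<close>.
  The argument \<open>lift\<close> chooses a representing matrix for each element of \<open>PSL2Z\<close>, and \<open>G\<close> is the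
  Veech group.
\<close>

type_synonym state = "(int^2^2) set list \<times> (int^2^2) set list \<times> nat"

definition process ::
  "((int^2^2) set \<Rightarrow> int^2^2) \<Rightarrow> (int^2^2) set \<Rightarrow> int^2^2 \<Rightarrow>
   (int^2^2) set list \<times> (int^2^2) set list \<Rightarrow> (int^2^2) set list \<times> (int^2^2) set list" where
  "process lift G B = (\<lambda>(Rep, Gen).
     let Ds = filter (\<lambda>d. B ** inv\<^bsub>SL2Z\<^esub> (lift d) \<in> G \<or> - (B ** inv\<^bsub>SL2Z\<^esub> (lift d)) \<in> G) Rep
     in if Ds = [] then (Rep @ [PSL_class B], Gen)
        else (Rep, Gen @ map (\<lambda>d. PSL_class B \<otimes>\<^bsub>PSL2Z\<^esub> inv\<^bsub>PSL2Z\<^esub> d) Ds))"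

definition stopped :: "state \<Rightarrow> bool" where
  "stopped = (\<lambda>(Rep, Gen, i). i \<ge> length Rep)"

definition step :: "((int^2^2) set \<Rightarrow> int^2^2) \<Rightarrow> (int^2^2) set \<Rightarrow> state \<Rightarrow> state" where
  "step lift G = (\<lambda>(Rep, Gen, i).
     if stopped (Rep, Gen, i) then (Rep, Gen, i)
     else let A = lift (Rep ! i);
              (Rep', Gen') = process lift G (A ** S_mat) (process lift G (A ** T_mat) (Rep, Gen))
          in (Rep', Gen', Suc i))"

definition run :: "((int^2^2) set \<Rightarrow> int^2^2) \<Rightarrow> (int^2^2) set \<Rightarrow> nat \<Rightarrow> state" where
  "run lift G n = (step lift G ^^ n) ([PSL_class (mat 1)], [], 0)"

end

(*
  The group SL_2(Z) acts on the torus by automorphisms h_A fixing the puncture, and A^-1 B lies in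
  the Veech group as soon as the coverings h_A o p and h_B o p of the punctured torus are isomorphic.
  A covering of the punctured torus is determined by its restriction to the open unit square together
  with the two gluings across the edges; since h_A permutes the 2-torsion points, these
  gluings can be read off the finite p-fibre over the nonzero 2-torsion points.  So only finitely
  many isomorphism classes of coverings h_A o p occur and the Veech group has finite index.  The
  procedure enumerates the cosets of such a subgroup under right multiplication by the generators S
  and T, and the elements of Gen are Schreier generators.
*)

theory Submission
  imports Defs
begin

section \<open>Lifts of maps of the plane to covering spaces\<close>

text \<open>Neither paths nor fundamental groups appear: coverings are compared through continuous
  lifts of \<open>torus_proj\<close> over open rectangles that miss the lattice. A 1 x 2 rectangle
  (\<open>domino\<close>) consists of two unit squares and the open edge between them, so its lifts
  record one gluing. The integral translates of the two kinds of dominoes cover the plane minus the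
  lattice. It therefore suffices that lifts exist over rectangles and are unique over connected
  sets.

  The obstacle is a finiteness bound uniform in A. Monodromy is stored as a set of pairs of points
  of X itself, not up to relabelling, and one finite subset of X contains these points for all A.
  Equality of data, rather than conjugacy, is then a relation with finitely many classes.

  Equal data yield a homeomorphism of X covering a torus automorphism. It is affine because, in
  charts, it differs from a linear map by a continuous function with lattice values.

  The invariant attached to A uses the inverse of A, since right cosets are compared through A
  B^-1.\<close>

definition lift_on :: "'a::topological_space set \<Rightarrow> ('a \<Rightarrow> 'b) \<Rightarrow> ('c::topological_space \<Rightarrow> 'b) \<Rightarrow> 'c set \<Rightarrow> ('c \<Rightarrow> 'a) \<Rightarrow> bool" where
  "lift_on X q f K s \<longleftrightarrow> continuous_on K s \<and> (\<forall>v\<in>K. s v \<in> X \<and> q (s v) = f v)"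

text \<open>This is the conclusion of the monodromy theorem for a simply connected K. Prescribing
  the value over an arbitrary point of K, rather than a base point, is what allows two liftable sets
  to be joined.\<close>

definition liftable :: "'a::topological_space set \<Rightarrow> ('a \<Rightarrow> 'b) \<Rightarrow> ('c::topological_space \<Rightarrow> 'b) \<Rightarrow> 'c set \<Rightarrow> bool" where
  "liftable X q f K \<longleftrightarrow> (\<forall>w\<in>K. \<forall>x\<in>X. q x = f w \<longrightarrow> (\<exists>s. lift_on X q f K s \<and> s w = x))"

lemma lift_on_subset: "lift_on X q f K s \<Longrightarrow> L \<subseteq> K \<Longrightarrow> lift_on X q f L s"
  unfolding lift_on_def by (auto intro: continuous_on_subset)

lemma liftable_subset: "liftable X q f K \<Longrightarrow> L \<subseteq> K \<Longrightarrow> liftable X q f L"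
  unfolding liftable_def
proof (intro ballI impI)
  fix w x assume "\<forall>w\<in>K. \<forall>x\<in>X. q x = f w \<longrightarrow> (\<exists>s. lift_on X q f K s \<and> s w = x)" and L: "L \<subseteq> K"
    and "w \<in> L" "x \<in> X" "q x = f w"
  then obtain s where "lift_on X q f K s" "s w = x"
    by blast
  then show "\<exists>s. lift_on X q f L s \<and> s w = x"
    using lift_on_subset[OF _ L] by blast
qed

lemma evenly_covered:
  assumes "covering_space X q Y" "y \<in> Y"
  obtains T v where "y \<in> T" "openin (top_of_set Y) T" "\<Union>v = X \<inter> q -` T"
    "\<And>u. u \<in> v \<Longrightarrow> openin (top_of_set X) u" "pairwise disjnt v"
    "\<And>u. u \<in> v \<Longrightarrow> inj_on q u" "\<And>u. u \<in> v \<Longrightarrow> \<exists>g. homeomorphism u T q g"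
proof -
  obtain T v where *: "y \<in> T" "openin (top_of_set Y) T" "\<Union>v = X \<inter> q -` T"
    "\<forall>u\<in>v. openin (top_of_set X) u" "pairwise disjnt v" "\<forall>u\<in>v. \<exists>g. homeomorphism u T q g"
    using assms unfolding covering_space_def by meson
  have inj: "inj_on q u" if u: "u \<in> v" for u
  proof -
    obtain g where "homeomorphism u T q g"
      using *(6) u by blast
    then show ?thesis
      by (intro inj_on_inverseI[of _ g]) (rule homeomorphism_apply1)
  qed
  show thesis
    by (rule that[OF *(1-3) _ *(5) inj]) (use *(4,6) in simp_all)
qed

text \<open>Agreement of s and t is locally constant: near w they stay in fixed sheets, which either
  coincide, where q is injective, or are disjoint. So the agreement set is clopen in K. Disjointness
  of sheets replaces a Hausdorff condition on X.\<close>

lemma lift_on_unique: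
  assumes cov: "covering_space X q Y" and K: "connected K" "a \<in> K"
    and s: "lift_on X q f K s" and t: "lift_on X q f K t" and "s a = t a" "v \<in> K"
  shows "s v = t v"
proof -
  let ?E = "{w \<in> K. s w = t w}"
  have nbhd: "\<exists>N. openin (top_of_set K) N \<and> w \<in> N \<and> (\<forall>z\<in>N. (s z = t z) = (s w = t w))" if w: "w \<in> K" for w
  proof -
    have "f w \<in> Y"
      using cov s w unfolding covering_space_def lift_on_def by (metis imageI)
    then obtain T V where T: "f w \<in> T" "\<Union>V = X \<inter> q -` T"
      "\<And>u. u \<in> V \<Longrightarrow> openin (top_of_set X) u" "pairwise disjnt V" "\<And>u. u \<in> V \<Longrightarrow> inj_on q u"
      using evenly_covered[OF cov] by metis
    have "s w \<in> \<Union>V" "t w \<in> \<Union>V"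
      using s t w T(1) unfolding T(2) lift_on_def by auto
    then obtain u u' where u: "u \<in> V" "s w \<in> u" "u' \<in> V" "t w \<in> u'"
      by blast
    let ?N = "(K \<inter> s -` u) \<inter> (K \<inter> t -` u')"
    have "openin (top_of_set K) ?N"
      using s t T(3) u unfolding lift_on_def
      by (intro openin_Int continuous_openin_preimage[where T = X]) auto
    moreover have "(s z = t z) = (s w = t w)" if z: "z \<in> ?N" for z
    proof (cases "u = u'")
      case True
      have "s z = t z" if "z \<in> ?N" for z
        using s t that True T(5)[OF u(1)] unfolding lift_on_def inj_on_def by auto
      then show ?thesis
        using z w u by auto
    next
      case False
      then have "u \<inter> u' = {}"
        using T(4) u by (auto simp: pairwise_def disjnt_def)
      then show ?thesis
        using z u by auto
    qed
    moreover have "w \<in> ?N"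
      using w u by blast
    ultimately show ?thesis
      by blast
  qed
  have "openin (top_of_set K) ?E"
  proof (subst openin_subopen, intro ballI)
    fix w assume w: "w \<in> ?E"
    then obtain N where N: "openin (top_of_set K) N" "w \<in> N" "\<forall>z\<in>N. (s z = t z) = (s w = t w)"
      using nbhd by blast
    have "N \<subseteq> ?E"
      using openin_imp_subset[OF N(1)] N(3) w by blast
    with N show "\<exists>N. openin (top_of_set K) N \<and> w \<in> N \<and> N \<subseteq> ?E"
      by blast
  qed
  moreover have "openin (top_of_set K) (K - ?E)"
  proof (subst openin_subopen, intro ballI)
    fix w assume w: "w \<in> K - ?E"
    then obtain N where N: "openin (top_of_set K) N" "w \<in> N" "\<forall>z\<in>N. (s z = t z) = (s w = t w)"
      using nbhd by blast
    have "N \<subseteq> K - ?E"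
      using openin_imp_subset[OF N(1)] N(3) w by blast
    with N show "\<exists>N. openin (top_of_set K) N \<and> w \<in> N \<and> N \<subseteq> K - ?E"
      by blast
  qed
  then have "closedin (top_of_set K) ?E"
    by (simp add: closedin_def)
  ultimately have E: "?E = K"
    using K \<open>s a = t a\<close> unfolding connected_clopen by blast
  have "v \<in> ?E"
    by (subst E) fact
  then show ?thesis
    by simp
qed

text \<open>Inside one sheet u the set \<open>s\<close>
  U\<open>contains the part of u lying over\<close>f \<open>U\<close>, and that part is open because
  f is open and q is continuous.\<close>

lemma lift_on_open_map:
  assumes cov: "covering_space X q Y" and s: "lift_on X q f V s" and "open V"
    and f: "\<And>U. open U \<Longrightarrow> U \<subseteq> V \<Longrightarrow> open (f ` U)"
  shows "openin (top_of_set X) (s ` V)"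
proof (subst openin_subopen, intro ballI)
  fix x assume "x \<in> s ` V"
  then obtain v where v: "v \<in> V" "x = s v"
    by blast
  have "f v \<in> Y"
    using cov s v unfolding covering_space_def lift_on_def by (metis imageI)
  then obtain T W where T: "f v \<in> T" "\<Union>W = X \<inter> q -` T"
    "\<And>u. u \<in> W \<Longrightarrow> openin (top_of_set X) u" "\<And>u. u \<in> W \<Longrightarrow> inj_on q u"
    using evenly_covered[OF cov] by metis
  have "s v \<in> \<Union>W"
    using s v T(1) unfolding T(2) lift_on_def by auto
  then obtain u where u: "u \<in> W" "s v \<in> u"
    by blast
  define U where "U = V \<inter> s -` u"
  have "openin (top_of_set V) U"
    unfolding U_def using s T(3)[OF u(1)] unfolding lift_on_def
    by (intro continuous_openin_preimage[where T = X]) auto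
  then have U: "open U" "U \<subseteq> V"
    using \<open>open V\<close> by (auto simp: openin_open_eq)
  have "openin (top_of_set X) (X \<inter> q -` (f ` U))"
    using cov f[OF U] unfolding covering_space_def
    by (intro continuous_openin_preimage_gen) auto
  then have "openin (top_of_set X) (u \<inter> (X \<inter> q -` (f ` U)))"
    using T(3)[OF u(1)] by blast
  moreover have "u \<inter> (X \<inter> q -` (f ` U)) \<subseteq> s ` V"
  proof
    fix y assume y: "y \<in> u \<inter> (X \<inter> q -` (f ` U))"
    then obtain z where z: "z \<in> U" "q y = f z"
      by auto
    then have "q (s z) = q y" "s z \<in> u"
      using s by (auto simp: U_def lift_on_def)
    then have "s z = y"
      using T(4)[OF u(1)] y by (auto dest: inj_onD)
    then show "y \<in> s ` V"
      using z by (auto simp: U_def)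
  qed
  moreover have "x \<in> u \<inter> (X \<inter> q -` (f ` U))"
    using v u s by (auto simp: U_def lift_on_def)
  ultimately show "\<exists>S. openin (top_of_set X) S \<and> x \<in> S \<and> S \<subseteq> s ` V"
    by blast
qed

text \<open>Start on the set containing the prescribed point, then continue from any common point m.
  Connectedness of the overlap makes the two lifts agree on all of it, and closedness of the pieces
  makes the pasted map continuous.\<close>

lemma liftable_Un:
  assumes cov: "covering_space X q Y" and K: "closed K" "closed L" "connected (K \<inter> L)" "K \<inter> L \<noteq> {}"
    and "liftable X q f K" "liftable X q f L"
  shows "liftable X q f (K \<union> L)"
proof -
  \<comment> \<open>K and L are quantified afresh, since the prescribed point may lie in either set
    and the roles are exchanged in the second case.\<close>
  have *: "\<exists>s. lift_on X q f (K \<union> L) s \<and> s w = x"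
    if K: "closed K" "closed L" "connected (K \<inter> L)" "K \<inter> L \<noteq> {}" "liftable X q f K" "liftable X q f L"
      and w: "w \<in> K" "x \<in> X" "q x = f w" for w x K L
  proof -
    obtain s where s: "lift_on X q f K s" "s w = x"
      using K w unfolding liftable_def by blast
    obtain m where m: "m \<in> K" "m \<in> L"
      using K by blast
    then have "s m \<in> X" "q (s m) = f m"
      using s unfolding lift_on_def by auto
    then obtain t where t: "lift_on X q f L t" "t m = s m"
      using K m unfolding liftable_def by blast
    have eq: "s v = t v" if "v \<in> K" "v \<in> L" for v
      by (rule lift_on_unique[OF cov K(3), of m]) (use m that s t in \<open>auto intro: lift_on_subset\<close>)
    have "lift_on X q f (K \<union> L) (\<lambda>v. if v \<in> K then s v else t v)"
      unfolding lift_on_def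
    proof
      show "continuous_on (K \<union> L) (\<lambda>v. if v \<in> K then s v else t v)"
        using s t K eq unfolding lift_on_def by (intro continuous_on_cases) auto
    qed (use s t in \<open>auto simp: lift_on_def\<close>)
    then show ?thesis
      using s w by (intro exI[of _ "\<lambda>v. if v \<in> K then s v else t v"]) auto
  qed
  show ?thesis
    unfolding liftable_def
  proof (intro ballI impI)
    fix w x assume w: "w \<in> K \<union> L" "x \<in> X" "q x = f w"
    show "\<exists>s. lift_on X q f (K \<union> L) s \<and> s w = x"
    proof (cases "w \<in> K")
      case True
      then show ?thesis
        using *[of K L w x] w assms by blast
    next
      case False
      then show ?thesis
        using *[of L K w x] w assms unfolding Int_commute[of L K] Un_commute[of L K] by blast
    qed
  qed
qed

text \<open>Over the preimage of an evenly covered set, lifts are obtained by composing f with the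
  inverse of q on the sheet through the prescribed point.\<close>

lemma liftable_nbhd:
  assumes cov: "covering_space X q Y" and f: "continuous_on W f" "open W" "f ` W \<subseteq> Y" "v \<in> W"
  obtains N where "open N" "v \<in> N" "liftable X q f N"
proof -
  obtain T V where T: "f v \<in> T" "openin (top_of_set Y) T" "\<Union>V = X \<inter> q -` T"
    "\<And>u. u \<in> V \<Longrightarrow> \<exists>g. homeomorphism u T q g"
    by (rule evenly_covered[OF cov, of "f v"]) (use f in auto)
  define N where "N = W \<inter> f -` T"
  have "openin (top_of_set W) N"
    unfolding N_def using f T by (intro continuous_openin_preimage[where T = Y]) auto
  then have "open N"
    using f by (simp add: openin_open_eq)
  moreover have "v \<in> N"
    using f T by (simp add: N_def)
  moreover have "liftable X q f N"
    unfolding liftable_def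
  proof (intro ballI impI)
    fix w x assume w: "w \<in> N" "x \<in> X" "q x = f w"
    then have "x \<in> \<Union>V"
      unfolding T(3) by (simp add: N_def)
    then obtain u where u: "u \<in> V" "x \<in> u"
      by blast
    then obtain g where g: "homeomorphism u T q g"
      using T(4) by blast
    have "continuous_on N (g \<circ> f)"
      using g f unfolding homeomorphism_def
      by (intro continuous_on_compose) (auto simp: N_def intro: continuous_on_subset)
    moreover have "g z \<in> u" if "z \<in> T" for z
      using g that by (auto simp: homeomorphism_def)
    moreover have "u \<subseteq> X"
      using u T(3) by blast
    ultimately have "lift_on X q f N (g \<circ> f)"
      using g unfolding lift_on_def by (auto simp: N_def homeomorphism_def)
    moreover have "(g \<circ> f) w = x"
      using g u w by (metis comp_apply homeomorphism_apply1)
    ultimately show "\<exists>s. lift_on X q f N s \<and> s w = x"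
      by blast
  qed
  ultimately show thesis
    using that by blast
qed

section \<open>Existence of lifts over rectangles\<close>

text \<open>Degenerate rectangles are included, so that the common edge of two adjacent rectangles
  is again a \<open>rect\<close>, connected and nonempty.\<close>

definition rect :: "real \<Rightarrow> real \<Rightarrow> real \<Rightarrow> real \<Rightarrow> (real^2) set" where
  "rect a b c d = {v. a \<le> v $ 1 \<and> v $ 1 \<le> b \<and> c \<le> v $ 2 \<and> v $ 2 \<le> d}"

lemma rect_eq_cbox: "rect a b c d = cbox (vector [a, c]) (vector [b, d])"
  by (auto simp: rect_def mem_box_cart forall_2)

lemma connected_rect: "connected (rect a b c d)" and closed_rect: "closed (rect a b c d)"
  by (simp_all add: rect_eq_cbox convex_connected closed_cbox)

lemma rect_nonempty: "a \<le> b \<Longrightarrow> c \<le> d \<Longrightarrow> rect a b c d \<noteq> {}"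
  using vector_2[of a c] unfolding rect_def by (auto intro!: exI[of _ "vector [a, c]"])

lemma liftable_rect_Un_horizontal:
  assumes "covering_space X q Y" "liftable X q f (rect a b c d)" "liftable X q f (rect b b' c d)"
    "a \<le> b" "b \<le> b'" "c \<le> d"
  shows "liftable X q f (rect a b' c d)"
proof -
  have "rect a b' c d = rect a b c d \<union> rect b b' c d" "rect a b c d \<inter> rect b b' c d = rect b b c d"
    using assms by (auto simp: rect_def)
  then show ?thesis
    using liftable_Un[OF assms(1) closed_rect closed_rect _ _ assms(2,3)] assms
    by (simp add: connected_rect rect_nonempty)
qed

lemma liftable_rect_Un_vertical:
  assumes "covering_space X q Y" "liftable X q f (rect a b c d)" "liftable X q f (rect a b d d')"
    "a \<le> b" "c \<le> d" "d \<le> d'"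
  shows "liftable X q f (rect a b c d')"
proof -
  have "rect a b c d' = rect a b c d \<union> rect a b d d'" "rect a b c d \<inter> rect a b d d' = rect a b d d"
    using assms by (auto simp: rect_def)
  then show ?thesis
    using liftable_Un[OF assms(1) closed_rect closed_rect _ _ assms(2,3)] assms
    by (simp add: connected_rect rect_nonempty)
qed

text \<open>Bisection is applied once per coordinate in place of a Lebesgue number: first
  vertically, giving a thin liftable strip around each abscissa, then horizontally, joining strips
  along common edges.\<close>

lemma liftable_rect:
  fixes f :: "real^2 \<Rightarrow> 'b::topological_space"
  assumes cov: "covering_space X q Y" and f: "continuous_on W f" "open W" "f ` W \<subseteq> Y"
    and R: "rect a b c d \<subseteq> W"
  shows "liftable X q f (rect a b c d)"
proof (cases "a \<le> b \<and> c \<le> d")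
  case False
  then have "rect a b c d = {}"
    by (auto simp: rect_def)
  then show ?thesis
    by (simp add: liftable_def)
next
  case True
  \<comment> \<open>The width e may depend on x. When two stacked pieces are joined, the smaller of
    their widths is used.\<close>
  have strip: "\<exists>e>0. liftable X q f (rect (x - e) (x + e) c d)" if x: "a \<le> x" "x \<le> b" for x
  proof -
    have "c \<le> d" using True by simp
    then show ?thesis
    proof (induct rule: Bolzano)
      case (trans c m d)
        obtain e1 e2 where e: "e1 > 0" "liftable X q f (rect (x - e1) (x + e1) c m)"
          "e2 > 0" "liftable X q f (rect (x - e2) (x + e2) m d)"
          using trans by blast
        let ?e = "min e1 e2"
        have "liftable X q f (rect (x - ?e) (x + ?e) c m)" "liftable X q f (rect (x - ?e) (x + ?e) m d)"
          by (rule liftable_subset[OF e(2)] liftable_subset[OF e(4)]; auto simp: rect_def)+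
        then have "liftable X q f (rect (x - ?e) (x + ?e) c d)"
          by (rule liftable_rect_Un_vertical[OF cov]) (use trans e in auto)
        then show ?case
          using e by (intro exI[of _ ?e]) simp
    next
      case (local y)
      have "vector [x, y] \<in> W"
        using local x R by (auto simp: rect_def subset_iff)
      then obtain N where N: "open N" "vector [x, y] \<in> N" "liftable X q f N"
        using liftable_nbhd[OF cov f] by blast
      obtain e where e: "e > 0" "ball (vector [x, y]) e \<subseteq> N"
        using N openE by blast
      \<comment> \<open>With e/4 in each coordinate the distance is at most e/2 by the l1 bound,
        hence below e.\<close>
      have sub: "rect (x - e/4) (x + e/4) (y - e/4) (y + e/4) \<subseteq> N"
      proof
        fix v assume "v \<in> rect (x - e/4) (x + e/4) (y - e/4) (y + e/4)"
        then have "\<bar>(vector [x, y] - v) $ 1\<bar> \<le> e/4" "\<bar>(vector [x, y] - v) $ 2\<bar> \<le> e/4"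
          unfolding rect_def abs_le_iff by auto
        then have "dist (vector [x, y]) v < e"
          using norm_le_l1_cart[of "vector [x, y] - v"] e by (simp add: dist_norm sum_2)
        then show "v \<in> N"
          using e by auto
      qed
      show ?case
      proof (rule exI[of _ "e/4"], intro conjI allI impI)
        fix c' d' assume "c' \<le> y \<and> y \<le> d' \<and> d' - c' < e/4"
        then have "rect (x - e/4) (x + e/4) c' d' \<subseteq> N"
          using sub by (auto simp: rect_def)
        then show "\<exists>e>0. liftable X q f (rect (x - e) (x + e) c' d')"
          using e liftable_subset[OF N(3)] by (intro exI[of _ "e/4"]) auto
      qed (use e in auto)
    qed
  qed
  have "a \<le> b" using True by simp
  then show ?thesis
  proof (induct rule: Bolzano)
    case (trans a m b)
    then show ?case
      using liftable_rect_Un_horizontal[OF cov] True by blast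
  next
    case (local x)
    obtain e where e: "e > 0" "liftable X q f (rect (x - e) (x + e) c d)"
      using strip[OF local] by blast
    show ?case
    proof (intro exI[of _ e] conjI allI impI)
      fix a' b' assume "a' \<le> x \<and> x \<le> b' \<and> b' - a' < e"
      then show "liftable X q f (rect a' b' c d)"
        by (intro liftable_subset[OF e(2)]) (auto simp: rect_def)
    qed (use e in auto)
  qed
qed

definition open_rect :: "real \<Rightarrow> real \<Rightarrow> real \<Rightarrow> real \<Rightarrow> (real^2) set" where
  "open_rect a b c d = {v. a < v $ 1 \<and> v $ 1 < b \<and> c < v $ 2 \<and> v $ 2 < d}"

lemma open_rect_eq_box: "open_rect a b c d = box (vector [a, c]) (vector [b, d])"
  by (auto simp: open_rect_def mem_box_cart forall_2)

lemma open_open_rect: "open (open_rect a b c d)" and convex_open_rect: "convex (open_rect a b c d)"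
  by (simp_all add: open_rect_eq_box open_box)

text \<open>The open rectangle is exhausted by closed ones, shrunk by e on each side. The lifts with
  value x at w agree where they overlap, by uniqueness on the smaller rectangle, and so define one
  global lift.\<close>

lemma liftable_open_rect:
  fixes f :: "real^2 \<Rightarrow> 'b::topological_space"
  assumes cov: "covering_space X q Y" and f: "continuous_on (open_rect a b c d) f" "f ` open_rect a b c d \<subseteq> Y"
  shows "liftable X q f (open_rect a b c d)"
  unfolding liftable_def
proof (intro ballI impI)
  let ?W = "open_rect a b c d"
  fix w x assume w: "w \<in> ?W" "x \<in> X" "q x = f w"
  define K where "K e = rect (a + e) (b - e) (c + e) (d - e)" for e
  define I where "I e = open_rect (a + e) (b - e) (c + e) (d - e)" for e
  have I: "I e \<subseteq> K e" "open (I e)" for e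
    by (auto simp: I_def K_def open_open_rect) (auto simp: rect_def open_rect_def)
  have K: "connected (K e)" for e
    by (simp add: K_def connected_rect)
  have exh: "\<exists>e>0. u \<in> I e \<and> w \<in> K e" if u: "u \<in> ?W" for u
  proof -
    \<comment> \<open>The smallest distance of v to the four sides; any positive e below the margins
      of both u and w works.\<close>
    define \<delta> where "\<delta> v = Min {v $ 1 - a, b - v $ 1, v $ 2 - c, d - v $ 2}" for v :: "real^2"
    have "0 < \<delta> v \<and> (\<forall>e<\<delta> v. v \<in> I e)" if "v \<in> ?W" for v
      using that by (auto simp: \<delta>_def open_rect_def I_def)
    then have "0 < \<delta> u" "0 < \<delta> w" and *: "\<forall>e<\<delta> u. u \<in> I e" "\<forall>e<\<delta> w. w \<in> I e"
      using u w(1) by auto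
    then obtain e where "e > 0" "e < \<delta> u" "e < \<delta> w"
      using field_lbound_gt_zero by blast
    then show ?thesis
      using * I(1) by blast
  qed
  \<comment> \<open>The condition is moved inside the existential so that a lift can be chosen for
    every real e at once.\<close>
  have "\<exists>s. e > 0 \<and> w \<in> K e \<longrightarrow> lift_on X q f (K e) s \<and> s w = x" for e
  proof (cases "e > 0 \<and> w \<in> K e")
    case True
    have "K e \<subseteq> ?W"
      using True by (auto simp: K_def rect_def open_rect_def)
    then have "liftable X q f (K e)"
      using liftable_rect[OF cov f(1) open_open_rect f(2)] by (simp add: K_def)
    then show ?thesis
      using w True unfolding liftable_def by blast
  qed blast
  then have "\<exists>S. \<forall>e. e > 0 \<and> w \<in> K e \<longrightarrow> lift_on X q f (K e) (S e) \<and> S e w = x"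
    by (intro choice allI)
  then obtain S where "\<forall>e. e > 0 \<and> w \<in> K e \<longrightarrow> lift_on X q f (K e) (S e) \<and> S e w = x"
    by (rule exE)
  then have S: "lift_on X q f (K e) (S e)" "S e w = x" if "e > 0" "w \<in> K e" for e
    using that by auto
  have S_eq: "S e v = S e' v" if e: "e > 0" "e' > 0" "w \<in> K e" "w \<in> K e'" and v: "v \<in> K e" "v \<in> K e'" for e e' v
  proof -
    have sub: "K (max e e') \<subseteq> K e" "K (max e e') \<subseteq> K e'"
      by (auto simp: K_def rect_def)
    have mem: "w \<in> K (max e e')" "v \<in> K (max e e')"
      using e v by (simp_all add: max_def)
    have "S e w = S e' w"
      using S(2) e by simp
    then show ?thesis
      using lift_on_unique[OF cov K mem(1) lift_on_subset[OF S(1) sub(1)] lift_on_subset[OF S(1) sub(2)] _ mem(2)] e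
      by blast
  qed
  obtain r where r: "\<And>u. u \<in> ?W \<Longrightarrow> r u > 0 \<and> u \<in> I (r u) \<and> w \<in> K (r u)"
    using bchoice[of ?W "\<lambda>u e. e > 0 \<and> u \<in> I e \<and> w \<in> K e"] exh by blast
  define s where "s u = S (r u) u" for u
  \<comment> \<open>The value does not depend on the chosen margin \<open>r\<close>. Near u,
    therefore, s coincides with the single continuous lift \<open>S (r u)\<close>.\<close>
  have s_eq: "s v = S e v" if "e > 0" "w \<in> K e" "v \<in> K e" "v \<in> ?W" for e v
    unfolding s_def using r[OF that(4)] that(1-3) I(1)[of "r v"] by (intro S_eq) blast+
  have "continuous_on ?W s"
    unfolding continuous_on_eq_continuous_at[OF open_open_rect]
  proof
    fix u assume u: "u \<in> ?W"
    have "continuous_on (I (r u) \<inter> ?W) (S (r u))"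
      using S[of "r u"] r[OF u] I unfolding lift_on_def by (meson continuous_on_subset inf.coboundedI1)
    then have "continuous_on (I (r u) \<inter> ?W) s"
      by (subst continuous_on_cong[OF refl s_eq]) (use r[OF u] I in auto)
    then show "isCont s u"
      using r[OF u] u I(2) open_open_rect continuous_on_eq_continuous_at[of "I (r u) \<inter> ?W" s] by blast
  qed
  moreover have "s v \<in> X \<and> q (s v) = f v" if "v \<in> ?W" for v
    using S[of "r v"] r[OF that] I unfolding lift_on_def s_def by blast
  moreover have "s w = x"
    using S[of "r w"] r[OF w(1)] by (simp add: s_def)
  ultimately show "\<exists>s. lift_on X q f ?W s \<and> s w = x"
    unfolding lift_on_def by blast
qed


section \<open>Coverings of the punctured torus\<close>

definition int_lattice :: "(real^2) set" where
  "int_lattice = {k. \<forall>i. k $ i \<in> \<int>}"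

lemma int_lattice_closed:
  "0 \<in> int_lattice" "k \<in> int_lattice \<Longrightarrow> n \<in> int_lattice \<Longrightarrow> k + n \<in> int_lattice"
  "k \<in> int_lattice \<Longrightarrow> n \<in> int_lattice \<Longrightarrow> k - n \<in> int_lattice" "k \<in> int_lattice \<Longrightarrow> - k \<in> int_lattice"
  by (auto simp: int_lattice_def)

lemma torus_proj_eq_lattice: "torus_proj v = torus_proj w \<longleftrightarrow> v - w \<in> int_lattice"
  by (simp add: torus_proj_eq_iff int_lattice_def)

lemma torus_proj_in_Estar: "torus_proj v \<in> Estar \<longleftrightarrow> v \<notin> int_lattice"
  by (simp add: Estar_def torus_proj_eq_lattice)

abbreviation real_mat :: "int^2^2 \<Rightarrow> real^2^2" where
  "real_mat \<equiv> map_matrix real_of_int"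

lemma real_mat_mult: "real_mat (A ** B) = real_mat A ** real_mat B"
  by (simp add: vec_eq_iff map_matrix_def matrix_matrix_mult_def)

lemma real_mat_one: "real_mat (mat 1) = mat 1"
  by (simp add: vec_eq_iff map_matrix_def mat_def)

lemma real_mat_lattice: "v \<in> int_lattice \<Longrightarrow> real_mat A *v v \<in> int_lattice"
  by (auto simp: int_lattice_def matrix_vector_mult_def map_matrix_def intro!: Ints_sum Ints_mult)

text \<open>The endomorphism of the torus induced by A. The chosen representative does not matter
  because A preserves the lattice.\<close>

definition torus_map :: "int^2^2 \<Rightarrow> torus \<Rightarrow> torus" where
  "torus_map A y = torus_proj (real_mat A *v rep_torus y)"

lemma torus_map_proj: "torus_map A (torus_proj v) = torus_proj (real_mat A *v v)"
proof -
  have "rep_torus (torus_proj v) - v \<in> int_lattice"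
    unfolding torus_proj_eq_lattice[symmetric] by (rule Quotient_abs_rep[OF Quotient_torus])
  from real_mat_lattice[OF this] show ?thesis
    by (simp add: torus_map_def torus_proj_eq_lattice matrix_vector_mult_diff_distrib)
qed

lemma torus_map_mult: "torus_map (A ** B) y = torus_map A (torus_map B y)"
  using torus_proj_surj[of y] by (auto simp: torus_map_proj real_mat_mult matrix_vector_mul_assoc)

lemma torus_map_one: "torus_map (mat 1) y = y"
  using torus_proj_surj[of y] by (auto simp: torus_map_proj real_mat_one)

lemma continuous_on_torus_map: "continuous_on S (torus_map A)"
proof -
  have "torus_proj -` (torus_map A -` U) = (\<lambda>v. real_mat A *v v) -` (torus_proj -` U)" for U
    by (auto simp: torus_map_proj)
  moreover have "open ((\<lambda>v. real_mat A *v v) -` (torus_proj -` U))" if "open U" for U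
    using that by (intro open_vimage[OF _ matrix_vector_mult_linear_continuous_on]) (simp add: open_torus_def)
  ultimately have "continuous_on UNIV (torus_map A)"
    unfolding continuous_on_open_vimage[OF open_UNIV] by (simp add: open_torus_def)
  then show ?thesis
    using continuous_on_subset by blast
qed

text \<open>Both maps fix the puncture and are mutually inverse, so neither can send another point
  to it.\<close>

lemma homeomorphism_torus_map:
  assumes "A ** B = mat 1" "B ** A = mat 1"
  shows "homeomorphism Estar Estar (torus_map A) (torus_map B)"
proof -
  have inv: "torus_map A (torus_map B y) = y" "torus_map B (torus_map A y) = y" for y
    using assms by (simp_all add: torus_map_mult[symmetric] torus_map_one)
  have "torus_map C (torus_proj 0) = torus_proj 0" for C
    by (simp add: torus_map_proj)
  then have "torus_map A y \<in> Estar" "torus_map B y \<in> Estar" if "y \<in> Estar" for y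
    using that inv by (metis Compl_iff Estar_def singleton_iff)+
  then show ?thesis
    using inv by (intro homeomorphismI) (auto simp: continuous_on_torus_map)
qed

text \<open>The sheets stay the same; only the evenly covered sets downstairs are moved by
  h.\<close>

lemma covering_space_compose_homeomorphism:
  assumes cov: "covering_space X p Y" and h: "homeomorphism Y Z h h'"
  shows "covering_space X (h \<circ> p) Z"
proof (rule covering_spaceI)
  have p: "continuous_on X p" "p ` X = Y"
    using cov by (auto simp: covering_space_def)
  show "continuous_on X (h \<circ> p)"
    using p h by (intro continuous_on_compose) (auto simp: homeomorphism_def)
  show "(h \<circ> p) ` X = Z"
    using p h by (metis homeomorphism_image1 image_comp)
  fix z assume "z \<in> Z"
  then have "h' z \<in> Y"
    using h by (auto simp: homeomorphism_def)
  then obtain T v where T: "h' z \<in> T" "openin (top_of_set Y) T" "\<Union>v = X \<inter> p -` T"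
    "\<forall>u\<in>v. openin (top_of_set X) u" "pairwise disjnt v" "\<forall>u\<in>v. \<exists>g. homeomorphism u T p g"
    using cov unfolding covering_space_def by meson
  have "T \<subseteq> Y"
    using T(2) by (rule openin_imp_subset)
  have 1: "openin (top_of_set Z) (h ` T)"
    using homeomorphism_imp_open_map[OF h T(2)] .
  have 2: "z \<in> h ` T"
    using T(1) h \<open>z \<in> Z\<close> by (metis homeomorphism_apply2 image_eqI)
  have 3: "\<Union>v = X \<inter> (h \<circ> p) -` (h ` T)"
  proof -
    have "inj_on h Y"
      using homeomorphism_apply1[OF h] by (rule inj_on_inverseI)
    then have "h (p x) \<in> h ` T \<longleftrightarrow> p x \<in> T" if "x \<in> X" for x
      using that p(2) \<open>T \<subseteq> Y\<close> by (intro inj_on_image_mem_iff) auto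
    then have "X \<inter> (h \<circ> p) -` (h ` T) = X \<inter> p -` T"
      unfolding vimage_def comp_def by blast
    then show ?thesis
      by (simp only: T(3))
  qed
  have 4: "\<exists>g. homeomorphism u (h ` T) (h \<circ> p) g" if "u \<in> v" for u
  proof -
    obtain g where g: "homeomorphism u T p g"
      using T(6) \<open>u \<in> v\<close> by blast
    have "homeomorphism T (h ` T) h h'"
      by (rule homeomorphism_of_subsets[OF h]) (use \<open>T \<subseteq> Y\<close> in auto)
    with g show ?thesis
      using homeomorphism_compose by blast
  qed
  show "\<exists>T. z \<in> T \<and> openin (top_of_set Z) T \<and> (\<exists>v. \<Union>v = X \<inter> (h \<circ> p) -` T \<and>
      (\<forall>u\<in>v. openin (top_of_set X) u) \<and> pairwise disjnt v \<and> (\<forall>u\<in>v. \<exists>g. homeomorphism u T (h \<circ> p) g))"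
    by (intro exI[of _ "h ` T"] exI[of _ v] conjI ballI 1 2 3 4 T(4)[rule_format] T(5))
qed

section \<open>Dominoes and the centers of unit squares\<close>

text \<open>The index d is the direction of the long side and k the lower left corner. For a lattice
  corner the transversal coordinate lies strictly between consecutive integers, so the set misses
  the lattice.\<close>

definition domino :: "2 \<Rightarrow> real^2 \<Rightarrow> (real^2) set" where
  "domino d k = {v. \<forall>i. k $ i < v $ i \<and> v $ i < k $ i + (if i = d then 2 else 1)}"

definition centers :: "(real^2) set" where
  "centers = {v. \<forall>i. v $ i - 1/2 \<in> \<int>}"

abbreviation half :: "real^2" where
  "half \<equiv> (\<chi> i. 1/2)"

lemma domino_eq_open_rect:
  "domino d k = open_rect (k $ 1) (k $ 1 + (if 1 = d then 2 else 1)) (k $ 2) (k $ 2 + (if 2 = d then 2 else 1))"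
  by (auto simp: domino_def open_rect_def forall_2)

lemma open_domino: "open (domino d k)" and convex_domino: "convex (domino d k)"
  by (simp_all only: domino_eq_open_rect open_open_rect convex_open_rect)

lemma domino_translate: "v + n \<in> domino d (k + n) \<longleftrightarrow> v \<in> domino d k"
  by (simp add: domino_def algebra_simps)

lemma half_in_domino: "half \<in> domino d 0" "half + axis d 1 \<in> domino d 0"
  by (auto simp: domino_def axis_def)

lemma Ints_less_imp_add1_le: "(a::real) \<in> \<int> \<Longrightarrow> b \<in> \<int> \<Longrightarrow> a < b \<Longrightarrow> a + 1 \<le> b"
  by (auto elim!: Ints_cases)

lemma centers_domino:
  assumes "m \<in> centers" "m \<in> domino d 0"
  shows "m = half \<or> m = half + axis d 1"
proof -
  have half: "m $ i = 1/2" if "i \<noteq> d" for i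
  proof -
    have "m $ i - 1/2 = 0"
      using assms that unfolding centers_def domino_def abs_if
      by (intro Ints_nonzero_abs_less1) (auto dest: spec[of _ i])
    then show ?thesis by simp
  qed
  obtain n :: int where n: "m $ d - 1/2 = n"
    using assms by (auto simp: centers_def elim: Ints_cases)
  have "0 < m $ d" "m $ d < 2"
    using assms by (auto simp: domino_def dest: spec[of _ d])
  then have "n = 0 \<or> n = 1"
    using n by linarith
  then have "m $ d = 1/2 \<or> m $ d = 1/2 + 1"
    using n by auto
  then show ?thesis
  proof
    assume "m $ d = 1/2"
    then have "m $ i = 1/2" for i
      using half by (cases "i = d") auto
    then show ?thesis
      by (simp add: vec_eq_iff)
  next
    assume "m $ d = 1/2 + 1"
    then have "m $ i = (half + axis d 1) $ i" for i
      using half by (cases "i = d") (auto simp: axis_def)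
    then show ?thesis
      by (simp only: vec_eq_iff) simp
  qed
qed

lemma centers_translate: "m \<in> centers \<Longrightarrow> n \<in> int_lattice \<Longrightarrow> m + n \<in> centers"
  unfolding centers_def int_lattice_def
proof (intro CollectI allI)
  fix i assume "m \<in> {v. \<forall>i. v $ i - 1/2 \<in> \<int>}" "n \<in> {k. \<forall>i. k $ i \<in> \<int>}"
  then have "(m $ i - 1/2) + n $ i \<in> \<int>"
    by (intro Ints_add) auto
  then show "(m + n) $ i - 1/2 \<in> \<int>"
    by (simp add: algebra_simps)
qed

text \<open>Integral corners force two dominoes that meet to share a whole open unit square.\<close>

lemma domino_Int_center:
  assumes "k \<in> int_lattice" "k' \<in> int_lattice" "u \<in> domino d k" "u \<in> domino d' k'"
  obtains m where "m \<in> centers" "m \<in> domino d k" "m \<in> domino d' k'"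
proof
  \<comment> \<open>The coordinatewise maximum of the two corners is the lower left corner of a
    common square; adding 1/2 gives its center.\<close>
  let ?m = "(\<chi> i. max (k $ i) (k' $ i) + 1/2) :: real^2"
  show "?m \<in> centers"
    using assms by (auto simp: centers_def int_lattice_def max_def)
  have *: "max (k $ i) (k' $ i) + 1 \<le> k $ i + (if i = d then 2 else 1)"
      "max (k $ i) (k' $ i) + 1 \<le> k' $ i + (if i = d' then 2 else 1)" for i
  proof -
    have lt: "max (k $ i) (k' $ i) < k $ i + (if i = d then 2 else 1)"
      "max (k $ i) (k' $ i) < k' $ i + (if i = d' then 2 else 1)"
      using assms(3,4) unfolding domino_def by (smt (verit) mem_Collect_eq)+
    have int: "max (k $ i) (k' $ i) \<in> \<int>" "k $ i + (if i = d then 2 else 1) \<in> \<int>"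
      "k' $ i + (if i = d' then 2 else 1) \<in> \<int>"
      using assms(1,2) by (auto simp: int_lattice_def max_def)
    show "max (k $ i) (k' $ i) + 1 \<le> k $ i + (if i = d then 2 else 1)"
      "max (k $ i) (k' $ i) + 1 \<le> k' $ i + (if i = d' then 2 else 1)"
      by (rule Ints_less_imp_add1_le[OF int(1,2) lt(1)] Ints_less_imp_add1_le[OF int(1,3) lt(2)])+
  qed
  show "?m \<in> domino d k" "?m \<in> domino d' k'"
    using *[of 1] *[of 2] by (auto simp: domino_def forall_2)
qed

lemma other_index: "\<exists>d :: 2. d \<noteq> i \<and> (\<forall>j. j \<noteq> i \<longrightarrow> j = d)"
  using exhaust_2[of i] by (elim disjE) (auto simp: forall_2 intro: exI[of _ 2] exI[of _ 1])

text \<open>Some coordinate i is not an integer. The long side is placed in the other direction,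
  where an integral coordinate may fall on the inner edge.\<close>

lemma domino_cover:
  assumes "v \<notin> int_lattice"
  obtains d k where "k \<in> int_lattice" "v \<in> domino d k"
proof -
  obtain i where i: "v $ i \<notin> \<int>"
    using assms by (auto simp: int_lattice_def)
  obtain d where d: "d \<noteq> i" "\<And>j. j \<noteq> i \<Longrightarrow> j = d"
    using other_index by blast
  \<comment> \<open>The largest integer strictly below each coordinate: ceiling minus one differs
    from the floor exactly at integers, where it puts v on the middle line of the domino.\<close>
  let ?k = "(\<chi> j. real_of_int (\<lceil>v $ j\<rceil> - 1)) :: real^2"
  have "?k \<in> int_lattice"
    by (simp add: int_lattice_def)
  moreover have "v \<in> domino d ?k"
    unfolding domino_def
  proof (intro CollectI allI conjI)
    fix j
    show "?k $ j < v $ j"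
      using ceiling_correct[of "v $ j"] by simp
    show "v $ j < ?k $ j + (if j = d then 2 else 1)"
    proof (cases "j = i")
      case True
      then have "v $ j \<noteq> of_int \<lceil>v $ j\<rceil>"
        using i by (metis Ints_of_int)
      then have "v $ j < of_int \<lceil>v $ j\<rceil>"
        using le_of_int_ceiling[of "v $ j"] by (simp add: less_le)
      then show ?thesis
        by auto
    next
      case False
      then have "j = d"
        by (rule d(2))
      moreover have "v $ j < of_int \<lceil>v $ j\<rceil> - 1 + 2"
        using le_of_int_ceiling[of "v $ j"] by linarith
      ultimately show ?thesis
        by simp
    qed
  qed
  ultimately show thesis
    using that by blast
qed

lemma domino_disjoint_lattice:
  assumes "k \<in> int_lattice" "v \<in> domino d k"
  shows "v \<notin> int_lattice"
proof
  assume v: "v \<in> int_lattice"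
  obtain i where i: "i \<noteq> d"
    using other_index by blast
  have "k $ i < v $ i" "v $ i < k $ i + 1"
    using assms(2) i unfolding domino_def by (auto dest: spec[of _ i])
  moreover have "k $ i + 1 \<le> v $ i"
    using assms(1) v calculation by (intro Ints_less_imp_add1_le) (auto simp: int_lattice_def)
  ultimately show False
    by simp
qed

lemma liftable_domino:
  assumes "covering_space X q Estar" "k \<in> int_lattice"
  shows "liftable X q torus_proj (domino d k)"
proof -
  have "torus_proj ` domino d k \<subseteq> Estar"
    using domino_disjoint_lattice[OF assms(2)] by (auto simp: torus_proj_in_Estar)
  then show ?thesis
    using assms(1) continuous_on_subset[OF continuous_on_torus_proj subset_UNIV]
    unfolding domino_eq_open_rect by (intro liftable_open_rect)
qed

lemma lift_on_domino_translate:
  assumes "lift_on X q torus_proj (domino d k) s" "n \<in> int_lattice"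
  shows "lift_on X q torus_proj (domino d (k + n)) (\<lambda>u. s (u - n))"
proof -
  have *: "u - n \<in> domino d k" if "u \<in> domino d (k + n)" for u
    using that domino_translate[of "u - n" n d k] by simp
  have "continuous_on (domino d (k + n)) (s \<circ> (\<lambda>u. u - n))"
    using assms * unfolding lift_on_def
    by (intro continuous_on_compose continuous_intros) (auto intro: continuous_on_subset)
  moreover have "torus_proj (u - n) = torus_proj u" for u
    using assms(2) by (simp add: torus_proj_eq_lattice int_lattice_closed)
  ultimately show ?thesis
    using assms * unfolding lift_on_def by (auto simp: o_def)
qed

text \<open>
  The graph of the permutation by which the horizontal (\<open>d = 1\<close>) or vertical (\<open>d = 2\<close>) closed
  geodesic through the center of the unit square acts on the fibre over that center.
\<close>

definition monodromy_data :: "'a::topological_space set \<Rightarrow> ('a \<Rightarrow> torus) \<Rightarrow> 2 \<Rightarrow> ('a \<times> 'a) set" where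
  "monodromy_data X q d = {(s half, s (half + axis d 1)) | s. lift_on X q torus_proj (domino d 0) s}"

text \<open>
  The graph of the isomorphism between two coverings with equal monodromy.  It is single-valued
  because overlapping dominoes share a unit square, on whose center the lifts agree.
\<close>

definition glue :: "'a::topological_space set \<Rightarrow> ('a \<Rightarrow> torus) \<Rightarrow> ('a \<Rightarrow> torus) \<Rightarrow> 'a \<Rightarrow> 'a \<Rightarrow> bool" where
  "glue X q r x y \<longleftrightarrow> (\<exists>d k s t v. k \<in> int_lattice \<and> v \<in> domino d k \<and>
     lift_on X q torus_proj (domino d k) s \<and> lift_on X r torus_proj (domino d k) t \<and>
     (\<forall>m\<in>centers \<inter> domino d k. s m = t m) \<and> x = s v \<and> y = t v)"

lemma glue_commute: "glue X q r x y \<longleftrightarrow> glue X r q y x"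
  unfolding glue_def by (rule iffI; elim exE conjE; intro exI conjI) (assumption | simp)+

lemma glue_over: "glue X q r x y \<Longrightarrow> x \<in> X \<and> y \<in> X \<and> q x = r y"
  unfolding glue_def lift_on_def by auto

text \<open>Agreement travels from v to a shared center and back. The lifts of q agree at v, hence
  at a center m of the overlap; there each lift of q equals its partner for r, so the lifts of r
  agree at m, hence at v.\<close>

lemma glue_unique:
  assumes q: "covering_space X q Estar" and r: "covering_space X r Estar"
    and "glue X q r x y" "glue X q r x z"
  shows "y = z"
proof -
  obtain d k s t v where 1: "k \<in> int_lattice" "v \<in> domino d k" "lift_on X q torus_proj (domino d k) s"
    "lift_on X r torus_proj (domino d k) t" "\<And>m. m \<in> centers \<Longrightarrow> m \<in> domino d k \<Longrightarrow> s m = t m" "x = s v" "y = t v"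
    using assms(3) unfolding glue_def by blast
  obtain d' k' s' t' v' where 2: "k' \<in> int_lattice" "v' \<in> domino d' k'" "lift_on X q torus_proj (domino d' k') s'"
    "lift_on X r torus_proj (domino d' k') t'" "\<And>m. m \<in> centers \<Longrightarrow> m \<in> domino d' k' \<Longrightarrow> s' m = t' m" "x = s' v'" "z = t' v'"
    using assms(4) unfolding glue_def by blast
  have "q x = torus_proj v" "q x = torus_proj v'"
    using 1 2 unfolding lift_on_def by auto
  then have n: "v - v' \<in> int_lattice"
    by (simp add: torus_proj_eq_lattice[symmetric])
  \<comment> \<open>Translating the second domino by this lattice vector makes both dominoes contain
    v. Their overlap is then convex, hence connected.\<close>
  define n where "n = v - v'"
  define l where "l = k' + n"
  let ?s = "\<lambda>u. s' (u - n)" and ?t = "\<lambda>u. t' (u - n)"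
  have l: "l \<in> int_lattice"
    using 2(1) n by (simp add: l_def n_def int_lattice_closed)
  have s: "lift_on X q torus_proj (domino d' l) ?s" and t: "lift_on X r torus_proj (domino d' l) ?t"
    using lift_on_domino_translate[OF 2(3) n] lift_on_domino_translate[OF 2(4) n] by (simp_all add: l_def n_def)
  have v: "v \<in> domino d' l"
    using 2(2) domino_translate[of v' n d' k'] by (simp add: l_def n_def)
  obtain m where m: "m \<in> centers" "m \<in> domino d k" "m \<in> domino d' l"
    using domino_Int_center[OF 1(1) l 1(2) v] by blast
  let ?W = "domino d k \<inter> domino d' l"
  have W: "connected ?W"
    by (intro convex_connected convex_Int convex_domino)
  have "m - n \<in> centers" "m - n \<in> domino d' k'"
    using centers_translate[OF m(1), of "- n"] int_lattice_closed(4)[OF n] m(3) domino_translate[of "m - n" n d' k']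
    by (simp_all add: n_def[symmetric] l_def)
  then have t_m: "?t m = ?s m"
    using 2(5) by simp
  have "s m = ?s m"
    by (rule lift_on_unique[OF q W _ lift_on_subset[OF 1(3)] lift_on_subset[OF s], of v])
       (use 1 2 v m in \<open>auto simp: n_def\<close>)
  then have "t m = ?t m"
    using t_m 1(5)[OF m(1,2)] by simp
  with m 1(2) v have "t v = ?t v"
    by (intro lift_on_unique[OF r W _ lift_on_subset[OF 1(4) Int_lower1] lift_on_subset[OF t Int_lower2] \<open>t m = ?t m\<close>]) simp_all
  then show ?thesis
    using 1(7) 2(7) by (simp add: n_def)
qed

text \<open>A lift of q through x over some domino is translated to the base domino, where it
  contributes a pair to the data. The same pair in the data of r supplies a partner lift with equal
  values at the only two centers.\<close>

lemma glue_exists: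
  assumes q: "covering_space X q Estar" and data: "monodromy_data X q = monodromy_data X r" and x: "x \<in> X"
  obtains y where "glue X q r x y"
proof -
  obtain v where v: "torus_proj v = q x"
    using torus_proj_surj by blast
  have "q x \<in> Estar"
    using q x unfolding covering_space_def by blast
  then have "v \<notin> int_lattice"
    using v by (metis torus_proj_in_Estar)
  then obtain d k where k: "k \<in> int_lattice" "v \<in> domino d k"
    using domino_cover by blast
  then obtain s where s: "lift_on X q torus_proj (domino d k) s" "s v = x"
    using liftable_domino[OF q k(1)] x v unfolding liftable_def by metis
  have "lift_on X q torus_proj (domino d 0) (\<lambda>u. s (u + k))"
    using lift_on_domino_translate[OF s(1) int_lattice_closed(4)[OF k(1)]] by simp
  then have "(s (half + k), s (half + axis d 1 + k)) \<in> monodromy_data X q d"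
    unfolding monodromy_data_def by (intro CollectI exI[of _ "\<lambda>u. s (u + k)"]) simp
  then obtain t where t: "lift_on X r torus_proj (domino d 0) t" "t half = s (half + k)"
    "t (half + axis d 1) = s (half + axis d 1 + k)"
    unfolding data monodromy_data_def by auto
  have "lift_on X r torus_proj (domino d k) (\<lambda>u. t (u - k))"
    using lift_on_domino_translate[OF t(1) k(1)] by simp
  moreover have "s m = t (m - k)" if m: "m \<in> centers" "m \<in> domino d k" for m
  proof -
    have "m - k \<in> centers" "m - k \<in> domino d 0"
      using centers_translate[OF m(1) int_lattice_closed(4)[OF k(1)]] m(2) domino_translate[of "m - k" k d 0] by simp_all
    then have "m - k = half \<or> m - k = half + axis d 1"
      by (rule centers_domino)
    then show ?thesis
      using t by (metis diff_add_cancel)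
  qed
  ultimately have "glue X q r x (t (v - k))"
    unfolding glue_def using k s by blast
  then show thesis
    using that by blast
qed

text \<open>Locally f sends \<open>s u\<close> to \<open>t u\<close> for a fixed pair of lifts, and
  s is an open map, so the s-image of the t-preimage of an open set is an open
  neighbourhood.\<close>

lemma glue_continuous:
  assumes q: "covering_space X q Estar" and r: "covering_space X r Estar"
    and f: "\<And>x. x \<in> X \<Longrightarrow> glue X q r x (f x)"
  shows "continuous_on X f"
  unfolding continuous_on_open_invariant
proof (intro allI impI)
  fix B :: "'a set" assume "open B"
  have "openin (top_of_set X) (X \<inter> f -` B)"
  proof (subst openin_subopen, intro ballI)
    fix x assume x: "x \<in> X \<inter> f -` B"
    then have "glue X q r x (f x)"
      using f by blast
    then obtain d k s t v where *: "k \<in> int_lattice" "v \<in> domino d k" "lift_on X q torus_proj (domino d k) s"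
      "lift_on X r torus_proj (domino d k) t" "\<forall>m\<in>centers \<inter> domino d k. s m = t m" "x = s v" "f x = t v"
      unfolding glue_def by blast
    define V where "V = domino d k \<inter> t -` B"
    have "openin (top_of_set (domino d k)) V"
      unfolding V_def using *(4) \<open>open B\<close> by (auto simp: lift_on_def intro: continuous_openin_preimage_gen)
    then have "open V"
      by (simp add: openin_open_eq open_domino)
    have "openin (top_of_set X) (s ` V)"
    proof (rule lift_on_open_map[OF q])
      show "lift_on X q torus_proj V s"
        by (rule lift_on_subset[OF *(3)]) (simp add: V_def)
    qed (simp_all add: \<open>open V\<close> open_torus_proj_image)
    moreover have "x \<in> s ` V"
      using * x by (auto simp: V_def)
    moreover have "s ` V \<subseteq> X \<inter> f -` B"
    proof
      fix y assume "y \<in> s ` V"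
      then obtain u where u: "u \<in> domino d k" "t u \<in> B" "y = s u"
        by (auto simp: V_def)
      then have g: "glue X q r y (t u)"
        unfolding glue_def using * by blast
      then have "y \<in> X"
        using glue_over by blast
      then have "f y = t u"
        using glue_unique[OF q r f g] by blast
      then show "y \<in> X \<inter> f -` B"
        using \<open>y \<in> X\<close> u by simp
    qed
    ultimately show "\<exists>S. openin (top_of_set X) S \<and> x \<in> S \<and> S \<subseteq> X \<inter> f -` B"
      by blast
  qed
  then obtain A where "open A" "X \<inter> f -` B = X \<inter> A"
    by (auto simp: openin_open)
  then show "\<exists>A. open A \<and> A \<inter> X = f -` B \<inter> X"
    by (intro exI[of _ A]) auto
qed

text \<open>Gluing is symmetric in the two coverings, and existence and uniqueness hold in both
  directions, so the relation is the graph of a bijection that is continuous both ways.\<close>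

lemma monodromy_data_determines_covering:
  assumes q: "covering_space X q Estar" and r: "covering_space X r Estar"
    and data: "monodromy_data X q = monodromy_data X r"
  obtains f g where "homeomorphism X X f g" "\<And>x. x \<in> X \<Longrightarrow> r (f x) = q x"
proof -
  define f where "f x = (SOME y. glue X q r x y)" for x
  define g where "g x = (SOME y. glue X r q x y)" for x
  have f: "glue X q r x (f x)" if "x \<in> X" for x
    using glue_exists[OF q data that] unfolding f_def by (metis someI)
  have g: "glue X r q x (g x)" if "x \<in> X" for x
    using glue_exists[OF r data[symmetric] that] unfolding g_def by (metis someI)
  have "g (f x) = x" if "x \<in> X" for x
  proof -
    have "f x \<in> X" "glue X r q (f x) x"
      using f[OF that] glue_over glue_commute by blast+
    then show ?thesis
      using glue_unique[OF r q g] by blast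
  qed
  moreover have "f (g x) = x" if "x \<in> X" for x
  proof -
    have "g x \<in> X" "glue X q r (g x) x"
      using g[OF that] glue_over glue_commute by blast+
    then show ?thesis
      using glue_unique[OF q r f] by blast
  qed
  moreover have "f ` X \<subseteq> X" "g ` X \<subseteq> X"
    using f g glue_over by blast+
  ultimately have "homeomorphism X X f g"
    using glue_continuous[OF q r f] glue_continuous[OF r q g] by (intro homeomorphismI)
  moreover have "r (f x) = q x" if "x \<in> X" for x
    using glue_over[OF f[OF that]] by simp
  ultimately show thesis
    using that by blast
qed

section \<open>Finiteness of the monodromy data\<close>

lemma finite_half_lattice_image: "finite (torus_proj ` {w. 2 *\<^sub>R w \<in> int_lattice})"
proof (rule finite_subset)
  show "torus_proj ` {w. 2 *\<^sub>R w \<in> int_lattice} \<subseteq> (\<lambda>(a, b). torus_proj (vector [a, b])) ` ({0, 1/2} \<times> {0, 1/2})"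
  proof clarify
    fix w :: "real^2" assume w: "2 *\<^sub>R w \<in> int_lattice"
    have "\<exists>a\<in>{0, 1/2}. w $ i - a \<in> \<int>" for i
    proof -
      obtain n :: int where n: "2 * w $ i = n"
        using w by (auto simp: int_lattice_def elim: Ints_cases)
      show ?thesis
      proof (cases "even n")
        case True
        then obtain m where "n = 2 * m" by blast
        then have "w $ i = of_int m" using n by simp
        then show ?thesis by simp
      next
        case False
        then obtain m where "n = 2 * m + 1" using oddE by blast
        then have "w $ i - 1/2 = of_int m" using n by simp
        then show ?thesis by simp
      qed
    qed
    then obtain a b where ab: "a \<in> {0, 1/2}" "w $ 1 - a \<in> \<int>" "b \<in> {0, 1/2}" "w $ 2 - b \<in> \<int>"
      by blast
    then have "torus_proj w = torus_proj (vector [a, b])"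
      by (simp add: torus_proj_eq_iff forall_2)
    then show "torus_proj w \<in> (\<lambda>(a, b). torus_proj (vector [a, b])) ` ({0, 1/2} \<times> {0, 1/2})"
      using ab by (intro image_eqI[of _ _ "(a, b)"]) auto
  qed
qed simp

text \<open>All data, for every A, consist of pairs from one finite set F: the points of X over the
  2-torsion. Only finitely many functions from the two directions to subsets of
  \<open>F \<times> F\<close> exist.\<close>

lemma finite_monodromy_data:
  assumes "origami X p"
  shows "finite ((\<lambda>A. monodromy_data X (torus_map A \<circ> p)) ` {A. \<exists>B. B ** A = mat 1})"
proof -
  define F where "F = {x \<in> X. p x \<in> torus_proj ` {w. 2 *\<^sub>R w \<in> int_lattice}}"
  have p: "p x \<in> Estar" if "x \<in> X" for x
    using assms that unfolding origami_def covering_space_def by blast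
  then have "F = (\<Union>y\<in>torus_proj ` {w. 2 *\<^sub>R w \<in> int_lattice} \<inter> Estar. {x \<in> X. p x = y})"
    unfolding F_def by blast
  then have "finite F"
    using assms finite_half_lattice_image unfolding origami_def by auto
  have "monodromy_data X (torus_map A \<circ> p) d \<in> Pow (F \<times> F)" if "B ** A = mat 1" for A B d
  proof -
    \<comment> \<open>Undoing A by its integral left inverse B shows that x lies over the image of
      \<open>B c\<close>, and doubling \<open>B c\<close> still gives a lattice vector.\<close>
    have "x \<in> F" if "x \<in> X" "torus_map A (p x) = torus_proj c" "2 *\<^sub>R c \<in> int_lattice" for x c
    proof -
      have "p x = torus_map B (torus_map A (p x))"
        by (simp add: torus_map_mult[symmetric] \<open>B ** A = mat 1\<close> torus_map_one)
      then have "p x = torus_proj (real_mat B *v c)"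
        by (simp add: that torus_map_proj)
      moreover have "2 *\<^sub>R (real_mat B *v c) \<in> int_lattice"
        using real_mat_lattice[OF that(3)] by (simp add: matrix_vector_mult_scaleR)
      ultimately show ?thesis
        using that by (auto simp: F_def)
    qed
    moreover have "2 *\<^sub>R half \<in> int_lattice" "2 *\<^sub>R (half + axis d 1) \<in> int_lattice"
      by (auto simp: int_lattice_def axis_def)
    ultimately show ?thesis
      using half_in_domino unfolding monodromy_data_def lift_on_def by fastforce
  qed
  then have "(\<lambda>A. monodromy_data X (torus_map A \<circ> p)) ` {A. \<exists>B. B ** A = mat 1} \<subseteq> UNIV \<rightarrow>\<^sub>E Pow (F \<times> F)"
    by (auto simp: PiE_def)
  moreover have "finite (UNIV \<rightarrow>\<^sub>E Pow (F \<times> F) :: (2 \<Rightarrow> ('a \<times> 'a) set) set)"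
    using \<open>finite F\<close> by (intro finite_PiE) auto
  ultimately show ?thesis
    by (rule finite_subset)
qed

lemma torus_maps_isomorphic:
  assumes O: "origami X p" and A: "A ** A' = mat 1" "A' ** A = mat 1" and B: "B ** B' = mat 1" "B' ** B = mat 1"
    and data: "monodromy_data X (torus_map A \<circ> p) = monodromy_data X (torus_map B \<circ> p)"
  obtains f g where "homeomorphism X X f g" "\<And>x. x \<in> X \<Longrightarrow> p (f x) = torus_map (B' ** A) (p x)"
proof -
  have p: "covering_space X p Estar"
    using O by (simp add: origami_def)
  obtain f g where f: "homeomorphism X X f g" "\<And>x. x \<in> X \<Longrightarrow> (torus_map B \<circ> p) (f x) = (torus_map A \<circ> p) x"
    using monodromy_data_determines_covering[OF
        covering_space_compose_homeomorphism[OF p homeomorphism_torus_map[OF A]]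
        covering_space_compose_homeomorphism[OF p homeomorphism_torus_map[OF B]] data] by blast
  have "p (f x) = torus_map (B' ** A) (p x)" if "x \<in> X" for x
  proof -
    have "torus_map B' (torus_map B (p (f x))) = torus_map B' (torus_map A (p x))"
      using f(2)[OF that] by simp
    then show ?thesis
      by (simp add: torus_map_mult[symmetric] B torus_map_one)
  qed
  with f(1) show thesis
    using that by blast
qed


section \<open>Veech groups of origamis\<close>

lemma affine_withE:
  assumes "affine_with Y \<A> A f" "(U, \<phi>) \<in> \<A>" "(V, \<psi>) \<in> \<A>" "x \<in> U" "f x \<in> V"
  obtains W b where "openin (top_of_set Y) W" "x \<in> W" "W \<subseteq> U" "f ` W \<subseteq> V"
    "\<And>y. y \<in> W \<Longrightarrow> \<psi> (f y) = A *v \<phi> y + b"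
proof -
  have "\<forall>(U, \<phi>)\<in>\<A>. \<forall>(V, \<psi>)\<in>\<A>. \<forall>x\<in>U. f x \<in> V \<longrightarrow>
      (\<exists>W b. openin (top_of_set Y) W \<and> x \<in> W \<and> W \<subseteq> U \<and> f ` W \<subseteq> V \<and> (\<forall>y\<in>W. \<psi> (f y) = A *v \<phi> y + b))"
    using assms(1) unfolding affine_with_def by (rule conjunct2)
  from bspec[OF this assms(2)]
  have "\<forall>(V, \<psi>)\<in>\<A>. \<forall>x\<in>U. f x \<in> V \<longrightarrow>
      (\<exists>W b. openin (top_of_set Y) W \<and> x \<in> W \<and> W \<subseteq> U \<and> f ` W \<subseteq> V \<and> (\<forall>y\<in>W. \<psi> (f y) = A *v \<phi> y + b))"
    by (simp only: prod.case)
  from bspec[OF this assms(3)]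
  have "\<exists>W b. openin (top_of_set Y) W \<and> x \<in> W \<and> W \<subseteq> U \<and> f ` W \<subseteq> V \<and> (\<forall>y\<in>W. \<psi> (f y) = A *v \<phi> y + b)"
    using assms(4,5) by (simp only: prod.case)
  then show thesis
    using that by blast
qed

lemma affine_with_homeomorphism: "affine_with Y \<A> A f \<Longrightarrow> \<exists>g. homeomorphism Y Y f g"
  unfolding affine_with_def by (rule conjunct1)

lemma affine_withI:
  assumes "homeomorphism Y Y f g"
    and "\<And>U \<phi> V \<psi> x. (U, \<phi>) \<in> \<A> \<Longrightarrow> (V, \<psi>) \<in> \<A> \<Longrightarrow> x \<in> U \<Longrightarrow> f x \<in> V \<Longrightarrow>
      \<exists>W b. openin (top_of_set Y) W \<and> x \<in> W \<and> W \<subseteq> U \<and> f ` W \<subseteq> V \<and> (\<forall>y\<in>W. \<psi> (f y) = A *v \<phi> y + b)"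
  shows "affine_with Y \<A> A f"
  unfolding affine_with_def
proof (intro conjI exI[of _ g] assms(1) ballI)
  fix c assume c: "c \<in> \<A>"
  obtain U \<phi> where U: "c = (U, \<phi>)"
    by (cases c)
  show "case c of (U, \<phi>) \<Rightarrow> \<forall>(V, \<psi>)\<in>\<A>. \<forall>x\<in>U. f x \<in> V \<longrightarrow> (\<exists>W b. openin (top_of_set Y) W \<and> x \<in> W \<and>
      W \<subseteq> U \<and> f ` W \<subseteq> V \<and> (\<forall>y\<in>W. \<psi> (f y) = A *v \<phi> y + b))"
    unfolding U prod.case
  proof (intro ballI)
    fix e assume e: "e \<in> \<A>"
    obtain V \<psi> where V: "e = (V, \<psi>)"
      by (cases e)
    show "case e of (V, \<psi>) \<Rightarrow> \<forall>x\<in>U. f x \<in> V \<longrightarrow> (\<exists>W b. openin (top_of_set Y) W \<and> x \<in> W \<and>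
        W \<subseteq> U \<and> f ` W \<subseteq> V \<and> (\<forall>y\<in>W. \<psi> (f y) = A *v \<phi> y + b))"
      unfolding V prod.case
      by (intro ballI impI assms(2)) (use c e U V in simp_all)
  qed
qed

text \<open>The image of a chart domain is open in the plane, so two affine expressions of the same
  map agree on a ball. Subtracting the values at its center leaves equality of the linear parts on
  small vectors.\<close>

lemma affine_with_unique:
  assumes Y: "translation_structure Y \<A>" "x \<in> Y"
    and A: "affine_with Y \<A> A f" and B: "affine_with Y \<A> B f"
  shows "A = B"
proof -
  have "f x \<in> Y"
    using affine_with_homeomorphism[OF A] Y(2) unfolding homeomorphism_def by blast
  have union: "(\<Union>(U, \<phi>)\<in>\<A>. U) = Y"
    using Y(1) unfolding translation_structure_def by blast
  obtain U \<phi> where U: "(U, \<phi>) \<in> \<A>" "x \<in> U"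
    using union Y(2) by blast
  obtain V \<psi> where V: "(V, \<psi>) \<in> \<A>" "f x \<in> V"
    using union \<open>f x \<in> Y\<close> by blast
  obtain W b where W: "openin (top_of_set Y) W" "x \<in> W" "W \<subseteq> U" "\<And>y. y \<in> W \<Longrightarrow> \<psi> (f y) = A *v \<phi> y + b"
    by (rule affine_withE[OF A U(1) V(1) U(2) V(2)]) (rule that; assumption)
  obtain W' b' where W': "openin (top_of_set Y) W'" "x \<in> W'" "W' \<subseteq> U" "\<And>y. y \<in> W' \<Longrightarrow> \<psi> (f y) = B *v \<phi> y + b'"
    by (rule affine_withE[OF B U(1) V(1) U(2) V(2)]) (rule that; assumption)
  obtain \<phi>' where chart: "openin (top_of_set Y) U" "open (\<phi> ` U)" "homeomorphism U (\<phi> ` U) \<phi> \<phi>'"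
    using Y(1) U unfolding translation_structure_def by blast
  have "openin (top_of_set U) (W \<inter> W')"
    using openin_subset_trans[OF openin_Int[OF W(1) W'(1)]] W(3) openin_imp_subset[OF chart(1)] by blast
  then have "openin (top_of_set (\<phi> ` U)) (\<phi> ` (W \<inter> W'))"
    by (rule homeomorphism_imp_open_map[OF chart(3)])
  then have "open (\<phi> ` (W \<inter> W'))"
    using openin_open_eq[OF chart(2)] by blast
  moreover have "\<phi> x \<in> \<phi> ` (W \<inter> W')"
    using W(2) W'(2) by blast
  ultimately obtain e where e: "e > 0" "ball (\<phi> x) e \<subseteq> \<phi> ` (W \<inter> W')"
    using openE by blast
  have eq: "A *v z + b = B *v z + b'" if z: "z \<in> ball (\<phi> x) e" for z
  proof -
    obtain y where "y \<in> W" "y \<in> W'" "z = \<phi> y"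
      using e z by blast
    then show ?thesis
      using W(4)[of y] W'(4)[of y] by simp
  qed
  have small: "A *v h = B *v h" if "norm h < e" for h
  proof -
    have "\<phi> x + h \<in> ball (\<phi> x) e" "\<phi> x \<in> ball (\<phi> x) e"
      using that e(1) by (auto simp: dist_norm)
    from eq[OF this(1)] eq[OF this(2)]
    have 1: "A *v \<phi> x + A *v h + b = B *v \<phi> x + B *v h + b'" and 2: "A *v \<phi> x + b = B *v \<phi> x + b'"
      by (simp_all only: matrix_vector_right_distrib)
    have "A *v h = (A *v \<phi> x + A *v h + b) - (A *v \<phi> x + b)"
      by simp
    also have "\<dots> = B *v h"
      unfolding 1 2 by simp
    finally show ?thesis .
  qed
  have "A *v h = B *v h" for h
  proof -
    \<comment> \<open>The factor c scales h to norm below e; the added 1 in the denominator also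
      covers h = 0.\<close>
    define c where "c = e / (norm h + 1)"
    have "c > 0"
      using e(1) norm_ge_zero[of h] by (simp add: c_def add_nonneg_pos)
    have "c * norm h < e"
      using e(1) norm_ge_zero[of h] by (simp add: c_def divide_less_eq mult_less_cancel_left add_nonneg_pos)
    then have "A *v (c *\<^sub>R h) = B *v (c *\<^sub>R h)"
      using \<open>c > 0\<close> by (intro small) simp
    then show ?thesis
      using \<open>c > 0\<close> by (simp add: matrix_vector_mult_scaleR)
  qed
  then show ?thesis
    by (simp add: matrix_eq)
qed

text \<open>Uniqueness of the linear part turns the definite description in \<open>der\<close> into
  an existence statement. Nonemptiness matters: on the empty surface every matrix would be a linear
  part.\<close>

lemma Veech_group_iff:
  assumes "translation_structure Y \<A>" "Y \<noteq> {}"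
  shows "A \<in> Veech_group Y \<A> \<longleftrightarrow> det A > 0 \<and> (\<exists>f. affine_with Y \<A> A f)"
proof -
  obtain x where "x \<in> Y"
    using assms(2) by blast
  then have "der Y \<A> f = B" if "affine_with Y \<A> B f" for f B
    unfolding der_def using that affine_with_unique[OF assms(1)] by (intro the_equality)
  then show ?thesis
    unfolding Veech_group_def Aff_plus_def by (auto simp: image_iff)
qed

lemma affine_with_id:
  assumes "translation_structure Y \<A>"
  shows "affine_with Y \<A> (mat 1) id"
proof (rule affine_withI)
  show "homeomorphism Y Y id id"
    using homeomorphism_ident by (simp add: id_def)
  fix U \<phi> V \<psi> x assume c: "(U, \<phi>) \<in> \<A>" "(V, \<psi>) \<in> \<A>" and x: "x \<in> U" "id x \<in> V"
  have "\<exists>W b. openin (top_of_set Y) W \<and> x \<in> W \<and> W \<subseteq> U \<inter> V \<and> (\<forall>y\<in>W. \<psi> y = \<phi> y + b)"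
    if "x \<in> U \<inter> V"
    using assms c that unfolding translation_structure_def by blast
  then obtain W b where "openin (top_of_set Y) W" "x \<in> W" "W \<subseteq> U \<inter> V" "\<forall>y\<in>W. \<psi> y = \<phi> y + b"
    using x by auto
  then show "\<exists>W b. openin (top_of_set Y) W \<and> x \<in> W \<and> W \<subseteq> U \<and> id ` W \<subseteq> V \<and>
      (\<forall>y\<in>W. \<psi> (id y) = mat 1 *v \<phi> y + b)"
    by (intro exI[of _ W] exI[of _ b]) simp
qed

lemma affine_with_compose:
  assumes Y: "translation_structure Y \<A>"
    and A: "affine_with Y \<A> A f" and B: "affine_with Y \<A> B g"
  shows "affine_with Y \<A> (A ** B) (f \<circ> g)"
proof -
  obtain f' g' where hom: "homeomorphism Y Y f f'" "homeomorphism Y Y g g'"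
    using affine_with_homeomorphism[OF A] affine_with_homeomorphism[OF B] by blast
  have "\<exists>W b. openin (top_of_set Y) W \<and> x \<in> W \<and> W \<subseteq> U \<and> (f \<circ> g) ` W \<subseteq> V \<and>
      (\<forall>y\<in>W. \<psi> ((f \<circ> g) y) = (A ** B) *v \<phi> y + b)"
    if c: "(U, \<phi>) \<in> \<A>" "(V, \<psi>) \<in> \<A>" and x: "x \<in> U" "(f \<circ> g) x \<in> V" for U \<phi> V \<psi> x
  proof -
    have union: "(\<Union>(U, \<phi>)\<in>\<A>. U) = Y"
      using Y unfolding translation_structure_def by blast
    have "x \<in> Y"
      using union c(1) x(1) by blast
    then have "g x \<in> Y"
      using hom(2) by (auto simp: homeomorphism_def)
    \<comment> \<open>An intermediate chart around \<open>g x\<close> is inserted, in which the two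
      local affine formulas can be composed.\<close>
    then obtain R \<rho> where R: "(R, \<rho>) \<in> \<A>" "g x \<in> R"
      using union by blast
    obtain W b where W: "openin (top_of_set Y) W" "x \<in> W" "W \<subseteq> U" "\<And>y. y \<in> W \<Longrightarrow> \<rho> (g y) = B *v \<phi> y + b"
      by (rule affine_withE[OF B c(1) R(1) x(1) R(2)]) (rule that; assumption)
    obtain W' b' where W': "openin (top_of_set Y) W'" "g x \<in> W'" "f ` W' \<subseteq> V"
      "\<And>y. y \<in> W' \<Longrightarrow> \<psi> (f y) = A *v \<rho> y + b'"
      by (rule affine_withE[OF A R(1) c(2) R(2), of thesis]) (use x(2) that in simp_all)
    let ?W = "W \<inter> (Y \<inter> g -` W')"
    have "openin (top_of_set Y) (Y \<inter> g -` W')"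
      using hom(2) W'(1) by (intro continuous_openin_preimage[where T = Y]) (auto simp: homeomorphism_def)
    then have "openin (top_of_set Y) ?W"
      using W(1) by blast
    moreover have "\<psi> ((f \<circ> g) y) = (A ** B) *v \<phi> y + (A *v b + b')" if "y \<in> ?W" for y
      using that W(4) W'(4)
      by (simp add: matrix_vector_right_distrib matrix_vector_mul_assoc add.assoc)
    moreover have "x \<in> ?W" "?W \<subseteq> U" "(f \<circ> g) ` ?W \<subseteq> V"
      using W W' \<open>x \<in> Y\<close> by auto
    ultimately show ?thesis
      by blast
  qed
  moreover have "homeomorphism Y Y (f \<circ> g) (g' \<circ> f')"
    using homeomorphism_compose[OF hom(2,1)] .
  ultimately show ?thesis
    by (rule affine_withI[rotated])
qed

lemma affine_with_inverse:
  assumes Y: "translation_structure Y \<A>" and A: "affine_with Y \<A> A f" and "A' ** A = mat 1"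
  obtains g where "affine_with Y \<A> A' g"
proof -
  obtain g where hom: "homeomorphism Y Y f g"
    using affine_with_homeomorphism[OF A] by blast
  have "\<exists>W b. openin (top_of_set Y) W \<and> x \<in> W \<and> W \<subseteq> U \<and> g ` W \<subseteq> V \<and> (\<forall>y\<in>W. \<psi> (g y) = A' *v \<phi> y + b)"
    if c: "(U, \<phi>) \<in> \<A>" "(V, \<psi>) \<in> \<A>" and x: "x \<in> U" "g x \<in> V" for U \<phi> V \<psi> x
  proof -
    have "U \<subseteq> Y"
      using Y c(1) unfolding translation_structure_def by blast
    then have "x \<in> Y"
      using x(1) by blast
    have fg: "f (g x) = x"
      using homeomorphism_apply2[OF hom \<open>x \<in> Y\<close>] .
    then have "f (g x) \<in> U"
      using x by simp
    then obtain W b where W: "openin (top_of_set Y) W" "g x \<in> W" "W \<subseteq> V" "f ` W \<subseteq> U"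
      "\<And>y. y \<in> W \<Longrightarrow> \<phi> (f y) = A *v \<psi> y + b"
      by (rule affine_withE[OF A c(2,1) x(2)]) (rule that; assumption)
    have gf: "g (f y) = y" if "y \<in> W" for y
      using homeomorphism_apply1[OF hom] openin_imp_subset[OF W(1)] that by blast
    have "openin (top_of_set Y) (f ` W)"
      by (rule homeomorphism_imp_open_map[OF hom W(1)])
    moreover have "x \<in> f ` W"
      using W(2) fg by (metis imageI)
    moreover have "g ` (f ` W) \<subseteq> V"
      using gf W(3) by auto
    \<comment> \<open>Solving z = A w + b for w gives the translation part
      \<open>- (A' *v b)\<close>.\<close>
    moreover have "\<psi> (g z) = A' *v \<phi> z + - (A' *v b)" if z: "z \<in> f ` W" for z
    proof -
      obtain y where y: "y \<in> W" "z = f y"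
        using z by blast
      have "A' *v \<phi> z = (A' ** A) *v \<psi> y + A' *v b"
        using W(5) y by (simp add: matrix_vector_right_distrib matrix_vector_mul_assoc)
      then show ?thesis
        using gf[OF y(1)] y(2) assms(3) by simp
    qed
    ultimately show ?thesis
      using W(4) by blast
  qed
  then have "affine_with Y \<A> A' g"
    by (rule affine_withI[OF homeomorphism_symD[OF hom]])
  then show thesis
    by (rule that)
qed

lemma Estar_atlasD:
  assumes "(V, \<phi>) \<in> Estar_atlas"
  shows "continuous_on V \<phi>" "\<And>y. y \<in> V \<Longrightarrow> torus_proj (\<phi> y) = y"
proof -
  obtain V' where V: "V = torus_proj ` V'" "open V'" "\<forall>v\<in>V'. \<phi> (torus_proj v) = v"
    using assms unfolding Estar_atlas_def by blast
  show "continuous_on V \<phi>"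
    using Estar_chart_homeomorphism[OF V(2)] V(1,3) by (auto simp: homeomorphism_def)
  show "torus_proj (\<phi> y) = y" if "y \<in> V" for y
    using that V by auto
qed

lemma int_lattice_small: "v \<in> int_lattice \<Longrightarrow> norm v < 1 \<Longrightarrow> v = 0"
  unfolding int_lattice_def
  by (metis (mono_tags, lifting) Ints_nonzero_abs_less1 component_le_norm_cart mem_Collect_eq
      order_le_less_trans vec_eq_iff zero_index)

text \<open>In charts, the difference between f and the linear map C is continuous, and it has
  lattice values because the charts are local sections of \<open>torus_proj\<close>. Hence it is
  locally constant, which is the affine form required.\<close>

lemma affine_with_torus_map_lift:
  assumes cov: "covering_space X p Estar" and hom: "homeomorphism X X f g"
    and f: "\<And>x. x \<in> X \<Longrightarrow> p (f x) = torus_map C (p x)"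
  shows "affine_with X (lifted_atlas X p Estar Estar_atlas) (real_mat C) f"
proof -
  have cont: "continuous_on X p" "continuous_on X f" "f ` X = X"
    using cov hom by (auto simp: covering_space_def homeomorphism_def)
  have "\<exists>W b. openin (top_of_set X) W \<and> x \<in> W \<and> W \<subseteq> U \<and> f ` W \<subseteq> V \<and>
      (\<forall>y\<in>W. \<psi> (p (f y)) = real_mat C *v \<phi> (p y) + b)"
    if c: "(U', \<phi>) \<in> Estar_atlas" "(V', \<psi>) \<in> Estar_atlas" "openin (top_of_set X) U" "openin (top_of_set X) V"
      "p ` U \<subseteq> U'" "p ` V \<subseteq> V'" and x: "x \<in> U" "f x \<in> V" for U' \<phi> V' \<psi> U V x
  proof -
    define N where "N = U \<inter> (X \<inter> f -` V)"
    have "openin (top_of_set X) (X \<inter> f -` V)"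
      using cont c(4) by (intro continuous_openin_preimage[where T = X]) auto
    then have N: "openin (top_of_set X) N"
      unfolding N_def using c(3) by blast
    have sub: "N \<subseteq> X" "p ` N \<subseteq> U'" "p ` f ` N \<subseteq> V'"
      using c by (auto simp: N_def)
    define h where "h y = \<psi> (p (f y)) - real_mat C *v \<phi> (p y)" for y
    have "continuous_on N (\<psi> \<circ> (p \<circ> f))" "continuous_on N (\<phi> \<circ> p)"
      using cont sub Estar_atlasD(1)[OF c(1)] Estar_atlasD(1)[OF c(2)]
      by (intro continuous_on_compose; force simp: image_comp intro: continuous_on_subset)+
    then have "continuous_on N h"
      unfolding h_def comp_def
      by (intro continuous_on_diff continuous_on_compose2[OF matrix_vector_mult_linear_continuous_on[of UNIV]]) auto
    \<comment> \<open>Distinct lattice vectors are at distance at least 1, so h is constant on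
      W.\<close>
    define W where "W = N \<inter> h -` ball (h x) 1"
    have "openin (top_of_set N) W"
      unfolding W_def using \<open>continuous_on N h\<close> by (intro continuous_openin_preimage_gen) auto
    then have "openin (top_of_set X) W"
      using N openin_trans by blast
    have int: "h y \<in> int_lattice" if "y \<in> N" for y
    proof -
      have "torus_proj (\<psi> (p (f y))) = p (f y)" "torus_proj (\<phi> (p y)) = p y"
        using Estar_atlasD(2)[OF c(1)] Estar_atlasD(2)[OF c(2)] sub that by blast+
      then have "torus_proj (\<psi> (p (f y))) = torus_proj (real_mat C *v \<phi> (p y))"
        using f[of y] sub(1) that by (metis subsetD torus_map_proj)
      then show ?thesis
        by (simp add: h_def torus_proj_eq_lattice)
    qed
    have "x \<in> N"
      using x c(3) openin_imp_subset by (fastforce simp: N_def)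
    have "h y = h x" if "y \<in> W" for y
    proof -
      have "y \<in> N" "norm (h y - h x) < 1"
        using that by (auto simp: W_def dist_norm norm_minus_commute)
      then have "h y - h x = 0"
        using int \<open>x \<in> N\<close> by (intro int_lattice_small int_lattice_closed)
      then show ?thesis by simp
    qed
    then have "\<forall>y\<in>W. \<psi> (p (f y)) = real_mat C *v \<phi> (p y) + h x"
      unfolding h_def by (metis add.commute diff_add_cancel)
    moreover have "x \<in> W" "W \<subseteq> U" "f ` W \<subseteq> V"
      using \<open>x \<in> N\<close> by (auto simp: W_def N_def)
    ultimately show ?thesis
      using \<open>openin (top_of_set X) W\<close> by blast
  qed
  note * = this
  show ?thesis
  proof (rule affine_withI[OF hom])
    fix U \<eta> V \<zeta> x
    assume "(U, \<eta>) \<in> lifted_atlas X p Estar Estar_atlas" "(V, \<zeta>) \<in> lifted_atlas X p Estar Estar_atlas"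
      and x: "x \<in> U" "f x \<in> V"
    then obtain U' \<phi> V' \<psi> where c: "(U', \<phi>) \<in> Estar_atlas" "(V', \<psi>) \<in> Estar_atlas"
      "openin (top_of_set X) U" "openin (top_of_set X) V" "p ` U \<subseteq> U'" "p ` V \<subseteq> V'"
      and eq: "\<eta> = \<phi> \<circ> p" "\<zeta> = \<psi> \<circ> p"
      unfolding lifted_atlas_def by blast
    show "\<exists>W b. openin (top_of_set X) W \<and> x \<in> W \<and> W \<subseteq> U \<and> f ` W \<subseteq> V \<and>
        (\<forall>y\<in>W. \<zeta> (f y) = real_mat C *v \<eta> y + b)"
      using *[OF c x] by (simp add: eq)
  qed
qed

lemma translation_structure_origami:
  "origami X p \<Longrightarrow> translation_structure X (lifted_atlas X p Estar Estar_atlas)"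
  by (simp add: origami_def translation_structure_lifted_atlas translation_structure_Estar)

lemma origami_nonempty:
  assumes "origami X p"
  shows "X \<noteq> {}"
proof -
  have "half \<notin> int_lattice"
    using domino_disjoint_lattice[OF int_lattice_closed(1) half_in_domino(1)] .
  then have "torus_proj half \<in> p ` X"
    using assms by (simp add: origami_def covering_space_def torus_proj_in_Estar)
  then show ?thesis
    by blast
qed

section \<open>The Veech group as a finite-index subgroup\<close>

lemma det_real_mat: "det (real_mat A) = real_of_int (det A)"
  by (simp add: det_2 map_matrix_def)

lemma Gamma_O_iff:
  assumes "origami X p"
  shows "A \<in> Gamma_O X p \<longleftrightarrow> A \<in> carrier SL2Z \<and>
    (\<exists>f. affine_with X (lifted_atlas X p Estar Estar_atlas) (real_mat A) f)"
  using Veech_group_iff[OF translation_structure_origami[OF assms] origami_nonempty[OF assms]]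
  by (auto simp: Gamma_O_def origami_Veech_group_def SL2Z_def det_real_mat)

lemma SL2Z_inverse:
  assumes "A \<in> carrier SL2Z"
  shows "A ** inv\<^bsub>SL2Z\<^esub> A = mat 1" "inv\<^bsub>SL2Z\<^esub> A ** A = mat 1"
  using group.r_inv[OF group_SL2Z assms] group.l_inv[OF group_SL2Z assms] by (simp_all add: SL2Z_def)

lemma subgroup_Gamma_O:
  assumes "origami X p"
  shows "subgroup (Gamma_O X p) SL2Z"
proof (rule group.subgroupI[OF group_SL2Z])
  note TS = translation_structure_origami[OF assms]
  show "Gamma_O X p \<subseteq> carrier SL2Z"
    by (auto simp: Gamma_O_def)
  have "mat 1 \<in> Gamma_O X p"
    unfolding Gamma_O_iff[OF assms] real_mat_one using affine_with_id[OF TS] by (auto simp: SL2Z_def)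
  then show "Gamma_O X p \<noteq> {}"
    by blast
  show "inv\<^bsub>SL2Z\<^esub> A \<in> Gamma_O X p" if A': "A \<in> Gamma_O X p" for A
  proof -
    have A: "A \<in> carrier SL2Z"
      using that by (simp add: Gamma_O_def)
    obtain f where f: "affine_with X (lifted_atlas X p Estar Estar_atlas) (real_mat A) f"
      using A' Gamma_O_iff[OF assms, of A] by blast
    have "real_mat (inv\<^bsub>SL2Z\<^esub> A) ** real_mat A = mat 1"
      by (simp add: real_mat_mult[symmetric] SL2Z_inverse[OF A] real_mat_one)
    from affine_with_inverse[OF TS f this] show ?thesis
      unfolding Gamma_O_iff[OF assms] using group.inv_closed[OF group_SL2Z A] by blast
  qed
  show "A \<otimes>\<^bsub>SL2Z\<^esub> B \<in> Gamma_O X p" if AB: "A \<in> Gamma_O X p" "B \<in> Gamma_O X p" for A B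
  proof -
    obtain f g where "affine_with X (lifted_atlas X p Estar Estar_atlas) (real_mat A) f"
      "affine_with X (lifted_atlas X p Estar Estar_atlas) (real_mat B) g"
      using AB Gamma_O_iff[OF assms, of A] Gamma_O_iff[OF assms, of B] by blast
    from affine_with_compose[OF TS this] show ?thesis
      using that unfolding Gamma_O_iff[OF assms]
      by (auto simp: SL2Z_def real_mat_mult det_mul)
  qed
qed

text \<open>Matrices with equal values of h lie in the same right coset of the Veech group. A finite
  range therefore bounds the index.\<close>

lemma Gamma_O_finite_index_invariant:
  fixes X :: "'a::topological_space set"
  assumes "origami X p"
  obtains h :: "int^2^2 \<Rightarrow> 2 \<Rightarrow> ('a \<times> 'a) set" where "finite (h ` carrier SL2Z)"
    "\<And>A B. A \<in> carrier SL2Z \<Longrightarrow> B \<in> carrier SL2Z \<Longrightarrow> h A = h B \<Longrightarrow> A \<otimes>\<^bsub>SL2Z\<^esub> inv\<^bsub>SL2Z\<^esub> B \<in> Gamma_O X p"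
proof (rule that)
  \<comment> \<open>The inverse is taken so that an isomorphism of coverings produces A B^-1,
    matching right cosets, rather than A^-1 B.\<close>
  let ?h = "\<lambda>A. monodromy_data X (torus_map (inv\<^bsub>SL2Z\<^esub> A) \<circ> p)"
  have "?h ` carrier SL2Z \<subseteq> (\<lambda>A. monodromy_data X (torus_map A \<circ> p)) ` {A. \<exists>B. B ** A = mat 1}"
    using SL2Z_inverse(1) by blast
  then show "finite (?h ` carrier SL2Z)"
    using finite_monodromy_data[OF assms] finite_subset by blast
  fix A B assume A: "A \<in> carrier SL2Z" and B: "B \<in> carrier SL2Z" and "?h A = ?h B"
  \<comment> \<open>The isomorphism runs from the covering of \<open>inv B\<close> to that of
    \<open>inv A\<close>; cancelling \<open>inv A\<close> on the left leaves the linear part A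
    B^-1.\<close>
  then obtain f g where "homeomorphism X X f g"
    "\<And>x. x \<in> X \<Longrightarrow> p (f x) = torus_map (A ** inv\<^bsub>SL2Z\<^esub> B) (p x)"
    using torus_maps_isomorphic[OF assms SL2Z_inverse(2)[OF B] SL2Z_inverse(1)[OF B]
        SL2Z_inverse(2)[OF A] SL2Z_inverse(1)[OF A]] by metis
  then have "affine_with X (lifted_atlas X p Estar Estar_atlas) (real_mat (A ** inv\<^bsub>SL2Z\<^esub> B)) f"
    using assms by (intro affine_with_torus_map_lift) (auto simp: origami_def)
  moreover have "A \<otimes>\<^bsub>SL2Z\<^esub> inv\<^bsub>SL2Z\<^esub> B \<in> carrier SL2Z"
    using A B group_SL2Z by (simp add: group.inv_closed monoid.m_closed group.is_monoid)
  ultimately show "A \<otimes>\<^bsub>SL2Z\<^esub> inv\<^bsub>SL2Z\<^esub> B \<in> Gamma_O X p"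
    unfolding Gamma_O_iff[OF assms] by (auto simp: SL2Z_def)
qed


section \<open>Correctness of the procedure\<close>

lemma SL2Z_simps: "carrier SL2Z = {A. det A = 1}" "A \<otimes>\<^bsub>SL2Z\<^esub> B = A ** B" "\<one>\<^bsub>SL2Z\<^esub> = mat 1"
  by (simp_all add: SL2Z_def)

lemma mat2_eq_iff: "A = B \<longleftrightarrow> A$1$1 = B$1$1 \<and> A$1$2 = B$1$2 \<and> A$2$1 = B$2$1 \<and> A$2$2 = B$2$2"
  for A B :: "'a^2^2"
  by (auto simp: vec_eq_iff forall_2)

lemma S_mat_mult: "(A ** S_mat)$i$1 = A$i$2" "(A ** S_mat)$i$2 = - A$i$1"
  by (simp_all add: S_mat_def matrix_matrix_mult_def sum_2)

lemma T_mat_mult: "(A ** T_mat)$i$1 = A$i$1" "(A ** T_mat)$i$2 = A$i$1 + A$i$2"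
  by (simp_all add: T_mat_def matrix_matrix_mult_def sum_2)

lemma S_T_mat_SL2Z: "S_mat \<in> carrier SL2Z" "T_mat \<in> carrier SL2Z"
  by (simp_all add: SL2Z_simps S_mat_def T_mat_def det_2)

text \<open>
  Closure under right multiplication by \<open>S\<close> and \<open>T\<close> alone suffices, since \<open>S\<close> has finite order and
  \<open>T\<inverse> = S T S T S\<^sup>3\<close>.
\<close>

lemma SL2Z_induct:
  assumes A: "A \<in> carrier SL2Z" and one: "P (mat 1)"
    and S: "\<And>A. P A \<Longrightarrow> P (A ** S_mat)" and T: "\<And>A. P A \<Longrightarrow> P (A ** T_mat)"
  shows "P A"
proof -
  \<comment> \<open>U is the inverse of \<open>T_mat\<close>. It allows entries to be reduced in
    both directions.\<close>
  define U :: "int^2^2" where "U = vector [vector [1, -1], vector [0, 1]]"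
  have U: "(A ** U)$i$1 = A$i$1" "(A ** U)$i$2 = A$i$2 - A$i$1" for A i
    by (simp_all add: U_def matrix_matrix_mult_def sum_2)
  have S': "P A" if "P (A ** S_mat)" for A
  proof -
    have "A ** S_mat ** S_mat ** S_mat ** S_mat = A"
      by (simp add: mat2_eq_iff S_mat_mult)
    then show ?thesis
      using S[OF S[OF S[OF that]]] by simp
  qed
  have T': "P A" if "P (A ** T_mat)" for A
  proof -
    have "A ** T_mat ** S_mat ** T_mat ** S_mat ** T_mat ** S_mat ** S_mat ** S_mat = A"
      by (simp add: mat2_eq_iff S_mat_mult T_mat_mult)
    then show ?thesis
      using S[OF S[OF S[OF T[OF S[OF T[OF S[OF that]]]]]]] by simp
  qed
  have U': "P A" if "P (A ** U)" for A
  proof -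
    have "A ** U ** T_mat = A"
      by (simp add: mat2_eq_iff U T_mat_mult)
    then show ?thesis
      using T[OF that] by simp
  qed
  have det: "det (A ** S_mat) = det A" "det (A ** T_mat) = det A" "det (A ** U) = det A" for A
    by (simp_all add: det_2 S_mat_mult T_mat_mult U algebra_simps)
  have "S_mat ** S_mat = - mat 1"
    by (simp add: mat2_eq_iff S_mat_mult) (simp add: S_mat_def mat_def)
  then have neg_one: "P (- mat 1)"
    using S[OF S[OF one]] by simp
  \<comment> \<open>Here the diagonal is (1, 1) or (-1, -1), so T or its inverse moves the upper
    right entry one step towards 0, ending at the identity or its negative.\<close>
  have upper: "P A" if "det A = 1" "A$2$1 = 0" for A
    using that
  proof (induction "nat \<bar>A$1$2\<bar>" arbitrary: A rule: less_induct)
    case less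
    have "A$1$1 * A$2$2 = 1"
      using less.prems by (simp add: det_2)
    then have a: "A$1$1 = 1 \<and> A$2$2 = 1 \<or> A$1$1 = -1 \<and> A$2$2 = -1"
      by (rule zmult_eq_1_iff[THEN iffD1])
    consider "A$1$2 = 0" | "A$1$2 \<noteq> 0" "\<bar>A$1$1 + A$1$2\<bar> < \<bar>A$1$2\<bar>" | "A$1$2 \<noteq> 0" "\<bar>A$1$2 - A$1$1\<bar> < \<bar>A$1$2\<bar>"
      using a by linarith
    then show ?case
    proof cases
      case 1
      then have "A = mat 1 \<or> A = - mat 1"
        using a less.prems by (auto simp: mat2_eq_iff mat_def)
      then show ?thesis
        using one neg_one by blast
    next
      case 2
      show ?thesis
        by (rule T', rule less.hyps) (use 2 less.prems in \<open>simp_all add: T_mat_mult det\<close>)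
    next
      case 3
      show ?thesis
        by (rule U', rule less.hyps) (use 3 less.prems in \<open>simp_all add: U det\<close>)
    qed
  qed
  have "det A = 1"
    using A by (simp add: SL2Z_simps)
  then show ?thesis
  proof (induction "nat (\<bar>A$2$1\<bar> + \<bar>A$2$2\<bar>)" arbitrary: A rule: less_induct)
    case less
    let ?c = "A$2$1" and ?d = "A$2$2"
    \<comment> \<open>Subtractive Euclidean algorithm on the bottom row (c, d). The products with T,
      U, ST, SU have bottom rows (c, c+d), (c, d-c), (d, d-c), (d, -c-d), and one of them has
      smaller absolute sum when c and d are nonzero.\<close>
    consider "?c = 0" | "?d = 0" | "?c \<noteq> 0" "?d \<noteq> 0" "\<bar>?c + ?d\<bar> < \<bar>?d\<bar>" | "?c \<noteq> 0" "?d \<noteq> 0" "\<bar>?d - ?c\<bar> < \<bar>?d\<bar>"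
      | "?c \<noteq> 0" "?d \<noteq> 0" "\<bar>?d - ?c\<bar> < \<bar>?c\<bar>" | "?c \<noteq> 0" "?d \<noteq> 0" "\<bar>- ?c - ?d\<bar> < \<bar>?c\<bar>"
      by linarith
    then show ?case
    proof cases
      case 1
      then show ?thesis
        using upper less.prems by blast
    next
      case 2
      then show ?thesis
        using less.prems by (intro S'[OF upper]) (simp_all add: det S_mat_mult)
    next
      case 3
      show ?thesis
        by (rule T', rule less.hyps) (use 3 less.prems in \<open>simp_all add: T_mat_mult det\<close>)
    next
      case 4
      show ?thesis
        by (rule U', rule less.hyps) (use 4 less.prems in \<open>simp_all add: U det\<close>)
    next
      case 5
      show ?thesis
        by (rule S', rule T', rule less.hyps) (use 5 less.prems in \<open>simp_all add: T_mat_mult S_mat_mult det\<close>)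
    next
      case 6
      show ?thesis
        by (rule S', rule U', rule less.hyps) (use 6 less.prems in \<open>simp_all add: U S_mat_mult det\<close>)
    qed
  qed
qed

section \<open>Cosets in the projective group\<close>

interpretation PSL: group PSL2Z
  by (rule group_PSL2Z)

lemma PSL_class_hom: "PSL_class \<in> hom SL2Z PSL2Z"
  using normal.r_coset_hom_Mod[OF normal_SL2Z] unfolding PSL2Z_def PSL_class_def[abs_def] .

lemma group_hom_PSL_class: "group_hom SL2Z PSL2Z PSL_class"
  using PSL_class_hom group_SL2Z group_PSL2Z by (simp add: group_hom_def group_hom_axioms_def)

lemma carrier_PSL2Z: "carrier PSL2Z = PSL_class ` carrier SL2Z"
  by (auto simp: PSL2Z_def FactGroup_def RCOSETS_def PSL_class_def)

lemma PSL_class_mult: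
  "A \<in> carrier SL2Z \<Longrightarrow> B \<in> carrier SL2Z \<Longrightarrow> PSL_class (A ** B) = PSL_class A \<otimes>\<^bsub>PSL2Z\<^esub> PSL_class B"
  using hom_mult[OF PSL_class_hom] by (simp add: SL2Z_simps)

lemma PSL_class_one: "PSL_class (mat 1) = \<one>\<^bsub>PSL2Z\<^esub>"
  using group_hom.hom_one[OF group_hom_PSL_class] by (simp add: SL2Z_simps)

lemma PSL_class_inv: "A \<in> carrier SL2Z \<Longrightarrow> PSL_class (inv\<^bsub>SL2Z\<^esub> A) = inv\<^bsub>PSL2Z\<^esub> PSL_class A"
  using group_hom.hom_inv[OF group_hom_PSL_class] by simp

text \<open>Fibres of the projection are pairs {A, -A}, which is why the procedure tests both
  signs.\<close>

lemma PSL_class_in_image: "PSL_class A \<in> PSL_class ` G \<longleftrightarrow> A \<in> G \<or> - A \<in> G"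
proof -
  have "PSL_class A = PSL_class B \<longleftrightarrow> B = A \<or> B = - A" for B
    unfolding PSL_class_eq doubleton_eq_iff by auto
  then show ?thesis
    by (auto simp: image_iff)
qed

lemma (in group) r_coset_eq_iff:
  assumes "subgroup H G" "a \<in> carrier G" "b \<in> carrier G"
  shows "H #> a = H #> b \<longleftrightarrow> a \<otimes> inv b \<in> H"
proof
  assume "H #> a = H #> b"
  then have "a \<in> H #> b"
    using rcos_self assms by blast
  then obtain h where "h \<in> H" "a = h \<otimes> b"
    unfolding r_coset_def by blast
  then show "a \<otimes> inv b \<in> H"
    using assms subgroup.mem_carrier[OF assms(1)] by (simp add: m_assoc)
next
  assume "a \<otimes> inv b \<in> H"
  moreover have "a = (a \<otimes> inv b) \<otimes> b"
    using assms by (simp add: m_assoc)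
  ultimately have "a \<in> H #> b"
    unfolding r_coset_def by blast
  then show "H #> a = H #> b"
    using repr_independence assms by metis
qed

section \<open>Loop invariant and termination\<close>

text \<open>Either alternative places b in the product of the subgroup generated by
  \<open>Gen\<close> with \<open>Rep\<close>, since b = (b d^-1) d.\<close>

definition covered :: "(int^2^2) set \<Rightarrow> (int^2^2) set list \<Rightarrow> (int^2^2) set list \<Rightarrow> bool" where
  "covered b Rep Gen \<longleftrightarrow> b \<in> set Rep \<or> (\<exists>d\<in>set Rep. b \<otimes>\<^bsub>PSL2Z\<^esub> inv\<^bsub>PSL2Z\<^esub> d \<in> set Gen)"

text \<open>The identity is kept in \<open>Rep\<close> as the representative of the trivial coset;
  the generation argument relies on this.\<close>

definition valid_lists :: "(int^2^2) set set \<Rightarrow> (int^2^2) set list \<Rightarrow> (int^2^2) set list \<Rightarrow> bool" where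
  "valid_lists H Rep Gen \<longleftrightarrow> set Rep \<subseteq> carrier PSL2Z \<and> \<one>\<^bsub>PSL2Z\<^esub> \<in> set Rep \<and>
     distinct (map (\<lambda>d. H #>\<^bsub>PSL2Z\<^esub> d) Rep) \<and> set Gen \<subseteq> H"

text \<open>\<open>Rep\<close> must grow as a prefix, so that earlier positions keep their entries,
  whereas \<open>Gen\<close> matters only as a set.\<close>

definition extends :: "'a list \<Rightarrow> 'a list \<Rightarrow> 'a list \<Rightarrow> 'a list \<Rightarrow> bool" where
  "extends Rep Gen Rep' Gen' \<longleftrightarrow> (\<exists>xs. Rep' = Rep @ xs) \<and> set Gen \<subseteq> set Gen'"

lemma covered_extends: "covered b Rep Gen \<Longrightarrow> extends Rep Gen Rep' Gen' \<Longrightarrow> covered b Rep' Gen'"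
  unfolding covered_def extends_def by auto

lemma extends_trans: "extends R G R' G' \<Longrightarrow> extends R' G' R'' G'' \<Longrightarrow> extends R G R'' G''"
  unfolding extends_def by auto

locale coset_enumeration =
  fixes lift :: "(int^2^2) set \<Rightarrow> int^2^2" and G :: "(int^2^2) set"
  assumes lift: "a \<in> carrier PSL2Z \<Longrightarrow> lift a \<in> a" and G: "subgroup G SL2Z"
begin

abbreviation H :: "(int^2^2) set set" where
  "H \<equiv> PSL_class ` G"

lemma subgroup_H: "subgroup H PSL2Z"
  by (rule group_hom.subgroup_img_is_subgroup[OF group_hom_PSL_class G])

lemma lift_class:
  assumes "a \<in> carrier PSL2Z"
  shows "lift a \<in> carrier SL2Z" "PSL_class (lift a) = a"
proof -
  obtain A where A: "A \<in> carrier SL2Z" "a = PSL_class A"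
    using assms carrier_PSL2Z by blast
  have "lift a = A \<or> lift a = - A"
    using lift[OF assms] A by (simp add: PSL_class_eq)
  moreover have "det (- A) = det A"
    by (simp add: det_2)
  ultimately show "lift a \<in> carrier SL2Z" "PSL_class (lift a) = a"
    using A by (auto simp: SL2Z_simps PSL_class_eq)
qed

text \<open>Testing both signs removes the dependence on the chosen lift, so the procedure really
  compares right cosets in the projective group.\<close>

lemma test_iff:
  assumes "B \<in> carrier SL2Z" "d \<in> carrier PSL2Z"
  shows "B ** inv\<^bsub>SL2Z\<^esub> (lift d) \<in> G \<or> - (B ** inv\<^bsub>SL2Z\<^esub> (lift d)) \<in> G \<longleftrightarrow>
    H #>\<^bsub>PSL2Z\<^esub> PSL_class B = H #>\<^bsub>PSL2Z\<^esub> d"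
proof -
  have "inv\<^bsub>SL2Z\<^esub> (lift d) \<in> carrier SL2Z"
    using lift_class(1)[OF assms(2)] group_SL2Z by (rule group.inv_closed[rotated])
  then have "PSL_class (B ** inv\<^bsub>SL2Z\<^esub> (lift d)) = PSL_class B \<otimes>\<^bsub>PSL2Z\<^esub> inv\<^bsub>PSL2Z\<^esub> d"
    using assms lift_class[OF assms(2)] by (simp add: PSL_class_mult PSL_class_inv)
  moreover have "PSL_class B \<in> carrier PSL2Z"
    using assms(1) carrier_PSL2Z by blast
  ultimately show ?thesis
    using PSL_class_in_image[of "B ** inv\<^bsub>SL2Z\<^esub> (lift d)" G] PSL.r_coset_eq_iff[OF subgroup_H _ assms(2)] by simp
qed

text \<open>A failed search means that the coset of B is new, which keeps the cosets distinct. A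
  successful one adds only quotients of elements of a common coset, which lie in H.\<close>

lemma process_correct:
  assumes valid: "valid_lists H Rep Gen" and B: "B \<in> carrier SL2Z"
    and eq: "process lift G B (Rep, Gen) = (Rep', Gen')"
  shows "valid_lists H Rep' Gen'" "extends Rep Gen Rep' Gen'" "covered (PSL_class B) Rep' Gen'"
proof -
  define Ds where "Ds = filter (\<lambda>d. B ** inv\<^bsub>SL2Z\<^esub> (lift d) \<in> G \<or> - (B ** inv\<^bsub>SL2Z\<^esub> (lift d)) \<in> G) Rep"
  have b: "PSL_class B \<in> carrier PSL2Z"
    using B carrier_PSL2Z by blast
  have Rep: "set Rep \<subseteq> carrier PSL2Z"
    using valid by (simp add: valid_lists_def)
  have Ds: "set Ds = {d \<in> set Rep. H #>\<^bsub>PSL2Z\<^esub> PSL_class B = H #>\<^bsub>PSL2Z\<^esub> d}"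
    unfolding Ds_def set_filter using test_iff[OF B] Rep by blast
  have "valid_lists H Rep' Gen' \<and> extends Rep Gen Rep' Gen' \<and> covered (PSL_class B) Rep' Gen'"
  proof (cases "Ds = []")
    case True
    then have eq': "Rep' = Rep @ [PSL_class B]" "Gen' = Gen"
      using eq by (simp_all add: process_def Ds_def[symmetric] del: filter_empty_conv)
    have "H #>\<^bsub>PSL2Z\<^esub> PSL_class B \<notin> set (map (\<lambda>d. H #>\<^bsub>PSL2Z\<^esub> d) Rep)"
      using Ds True by auto
    then show ?thesis
      using valid b by (auto simp: eq' valid_lists_def extends_def covered_def)
  next
    case False
    then have eq': "Rep' = Rep" "Gen' = Gen @ map (\<lambda>d. PSL_class B \<otimes>\<^bsub>PSL2Z\<^esub> inv\<^bsub>PSL2Z\<^esub> d) Ds"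
      using eq by (simp_all add: process_def Ds_def[symmetric] del: filter_empty_conv)
    have "PSL_class B \<otimes>\<^bsub>PSL2Z\<^esub> inv\<^bsub>PSL2Z\<^esub> d \<in> H" if "d \<in> set Ds" for d
      using PSL.r_coset_eq_iff[OF subgroup_H b, of d] that Rep unfolding Ds by blast
    then have "valid_lists H Rep' Gen'"
      using valid unfolding eq' valid_lists_def by auto
    moreover obtain d where "d \<in> set Ds"
      using False by (meson last_in_set)
    then have "covered (PSL_class B) Rep' Gen'"
      unfolding covered_def eq' using Ds by auto
    ultimately show ?thesis
      unfolding extends_def eq' by auto
  qed
  then show "valid_lists H Rep' Gen'" "extends Rep Gen Rep' Gen'" "covered (PSL_class B) Rep' Gen'"
    by blast+
qed

text \<open>The entries before position i are those already treated; coverage of their products with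
  S and T is what the loop has achieved so far.\<close>

definition invariant :: "state \<Rightarrow> bool" where
  "invariant = (\<lambda>(Rep, Gen, i). valid_lists H Rep Gen \<and> i \<le> length Rep \<and>
     (\<forall>j<i. \<forall>M\<in>{S_mat, T_mat}. covered (Rep ! j \<otimes>\<^bsub>PSL2Z\<^esub> PSL_class M) Rep Gen))"

lemma invariant_step:
  assumes "invariant s"
  shows "invariant (step lift G s)"
proof -
  obtain Rep Gen i where s: "s = (Rep, Gen, i)"
    by (cases s)
  show ?thesis
  proof (cases "stopped s")
    case True
    then show ?thesis
      using assms by (simp add: s step_def)
  next
    case False
    define A where "A = lift (Rep ! i)"
    obtain R1 G1 where 1: "process lift G (A ** T_mat) (Rep, Gen) = (R1, G1)"
      by fastforce
    obtain R2 G2 where 2: "process lift G (A ** S_mat) (R1, G1) = (R2, G2)"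
      by fastforce
    have i: "i < length Rep"
      using False by (simp add: s stopped_def)
    have valid: "valid_lists H Rep Gen"
      using assms by (simp add: s invariant_def)
    have a: "Rep ! i \<in> carrier PSL2Z"
      using valid i unfolding valid_lists_def by (meson nth_mem subsetD)
    have A: "A \<in> carrier SL2Z" "PSL_class A = Rep ! i"
      using lift_class[OF a] by (simp_all add: A_def)
    have AM: "A ** M \<in> carrier SL2Z" if "M \<in> carrier SL2Z" for M
      using A(1) that by (simp add: SL2Z_simps det_mul)
    note p1 = process_correct[OF valid AM[OF S_T_mat_SL2Z(2)] 1]
    note p2 = process_correct[OF p1(1) AM[OF S_T_mat_SL2Z(1)] 2]
    have ext: "extends Rep Gen R2 G2"
      using p1(2) p2(2) by (rule extends_trans)
    have nth: "R2 ! j = Rep ! j" if "j < Suc i" for j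
      using ext that i unfolding extends_def by (auto simp: nth_append)
    have "covered (Rep ! i \<otimes>\<^bsub>PSL2Z\<^esub> PSL_class T_mat) R2 G2"
      using covered_extends[OF p1(3) p2(2)] A S_T_mat_SL2Z by (simp add: PSL_class_mult)
    moreover have "covered (Rep ! i \<otimes>\<^bsub>PSL2Z\<^esub> PSL_class S_mat) R2 G2"
      using p2(3) A S_T_mat_SL2Z by (simp add: PSL_class_mult)
    moreover have "covered (Rep ! j \<otimes>\<^bsub>PSL2Z\<^esub> PSL_class M) R2 G2" if "j < i" "M \<in> {S_mat, T_mat}" for j M
      using assms that covered_extends[OF _ ext] by (auto simp: s invariant_def)
    ultimately have "\<forall>j<Suc i. \<forall>M\<in>{S_mat, T_mat}. covered (R2 ! j \<otimes>\<^bsub>PSL2Z\<^esub> PSL_class M) R2 G2"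
      using nth by (auto simp: less_Suc_eq)
    moreover have "Suc i \<le> length R2"
      using ext i unfolding extends_def by auto
    moreover have "step lift G s = (R2, G2, Suc i)"
      using False 1 2 by (simp add: s step_def A_def[symmetric])
    ultimately show ?thesis
      using p2(1) by (simp add: invariant_def)
  qed
qed

lemma run_Suc: "run lift G (Suc n) = step lift G (run lift G n)"
  by (simp add: run_def)

lemma invariant_run: "invariant (run lift G n)"
proof (induction n)
  case 0
  show ?case
    by (simp add: run_def invariant_def valid_lists_def PSL_class_one)
next
  case (Suc n)
  then show ?case
    by (simp add: run_Suc invariant_step)
qed

lemma run_position: "stopped (run lift G n) \<or> snd (snd (run lift G n)) = n"
proof (induction n)
  case 0
  show ?case
    by (simp add: run_def)
next
  case (Suc n)
  show ?case
  proof (cases "stopped (run lift G n)")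
    case True
    then show ?thesis
      by (cases "run lift G n") (simp add: run_Suc step_def)
  next
    case False
    then show ?thesis
      using Suc by (cases "run lift G n") (auto simp: run_Suc step_def Let_def split: prod.splits)
  qed
qed

text \<open>Take n to be the index of H. Distinct cosets bound the length of \<open>Rep\<close> by
  n, and after n steps the run has either stopped or reached position n, beyond the end of the
  list.\<close>

lemma run_stops:
  assumes fin: "finite (rcosets\<^bsub>PSL2Z\<^esub> H)"
  shows "\<exists>n. stopped (run lift G n)"
proof -
  define n where "n = card (rcosets\<^bsub>PSL2Z\<^esub> H)"
  obtain Rep Gen i where r: "run lift G n = (Rep, Gen, i)"
    by (cases "run lift G n")
  have valid: "valid_lists H Rep Gen"
    using invariant_run[of n] by (simp add: r invariant_def)
  have "length Rep = card (set (map (\<lambda>d. H #>\<^bsub>PSL2Z\<^esub> d) Rep))"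
    using valid distinct_card by (fastforce simp: valid_lists_def)
  also have "\<dots> \<le> n"
    unfolding n_def using fin
  proof (rule card_mono)
    show "set (map (\<lambda>d. H #>\<^bsub>PSL2Z\<^esub> d) Rep) \<subseteq> rcosets\<^bsub>PSL2Z\<^esub> H"
      using valid PSL.rcosetsI[OF subgroup.subset[OF subgroup_H]] by (auto simp: valid_lists_def)
  qed
  finally show ?thesis
    using run_position[of n] by (intro exI[of _ n]) (auto simp: r stopped_def)
qed

text \<open>The elements of the form h r, with h generated by \<open>Gen\<close> and r in
  \<open>Rep\<close>, contain the identity and are stable under right multiplication by S and T,
  hence exhaust the group.\<close>

lemma stopped_decomposition:
  assumes inv: "invariant (Rep, Gen, i)" and stop: "stopped (Rep, Gen, i)" and a: "a \<in> carrier PSL2Z"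
  obtains h r where "h \<in> generate PSL2Z (set Gen)" "r \<in> set Rep" "a = h \<otimes>\<^bsub>PSL2Z\<^esub> r"
proof -
  let ?K = "generate PSL2Z (set Gen)"
  define P where "P a \<longleftrightarrow> (\<exists>h\<in>?K. \<exists>r\<in>set Rep. a = h \<otimes>\<^bsub>PSL2Z\<^esub> r)" for a
  have valid: "valid_lists H Rep Gen"
    using inv by (simp add: invariant_def)
  then have Rep: "set Rep \<subseteq> carrier PSL2Z" and Gen: "set Gen \<subseteq> carrier PSL2Z"
    using subgroup.subset[OF subgroup_H] by (auto simp: valid_lists_def)
  have K: "?K \<subseteq> carrier PSL2Z"
    using Gen by (rule PSL.generate_incl)
  \<comment> \<open>On stopping, i equals the length of \<open>Rep\<close>, so the invariant speaks
    about every entry.\<close>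
  have cov: "covered (r \<otimes>\<^bsub>PSL2Z\<^esub> PSL_class M) Rep Gen" if "r \<in> set Rep" "M \<in> {S_mat, T_mat}" for r M
    using that inv stop unfolding invariant_def stopped_def in_set_conv_nth by fastforce
  have step: "P (a \<otimes>\<^bsub>PSL2Z\<^esub> PSL_class M)" if Pa: "P a" and M: "M \<in> {S_mat, T_mat}" for a M
  proof -
    obtain h r where hr: "h \<in> ?K" "r \<in> set Rep" "a = h \<otimes>\<^bsub>PSL2Z\<^esub> r"
      using Pa unfolding P_def by blast
    have m: "PSL_class M \<in> carrier PSL2Z"
      using M S_T_mat_SL2Z carrier_PSL2Z by blast
    let ?b = "r \<otimes>\<^bsub>PSL2Z\<^esub> PSL_class M"
    have b: "?b \<in> carrier PSL2Z"
      using hr Rep m by blast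
    have eq: "a \<otimes>\<^bsub>PSL2Z\<^esub> PSL_class M = h \<otimes>\<^bsub>PSL2Z\<^esub> ?b"
      using hr K Rep m by (simp add: PSL.m_assoc subset_iff)
    consider "?b \<in> set Rep" | d where "d \<in> set Rep" "?b \<otimes>\<^bsub>PSL2Z\<^esub> inv\<^bsub>PSL2Z\<^esub> d \<in> set Gen"
      using cov[OF hr(2) M] unfolding covered_def by blast
    then show ?thesis
    proof cases
      case 1
      then show ?thesis
        unfolding P_def eq using hr(1) by blast
    next
      case 2
      let ?g = "?b \<otimes>\<^bsub>PSL2Z\<^esub> inv\<^bsub>PSL2Z\<^esub> d"
      have d: "d \<in> carrier PSL2Z" and h: "h \<in> carrier PSL2Z"
        using 2(1) Rep hr(1) K by blast+
      have "h \<otimes>\<^bsub>PSL2Z\<^esub> ?g \<in> ?K"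
        by (rule generate.eng[OF hr(1) generate.incl[OF 2(2)]])
      moreover have "h \<otimes>\<^bsub>PSL2Z\<^esub> ?b = (h \<otimes>\<^bsub>PSL2Z\<^esub> ?g) \<otimes>\<^bsub>PSL2Z\<^esub> d"
        using h b d by (simp add: PSL.m_assoc)
      ultimately show ?thesis
        unfolding P_def eq using 2(1) by blast
    qed
  qed
  have "P \<one>\<^bsub>PSL2Z\<^esub>"
    unfolding P_def using valid generate.one[of PSL2Z "set Gen"]
    by (intro bexI[of _ "\<one>\<^bsub>PSL2Z\<^esub>"]) (auto simp: valid_lists_def)
  obtain A where A: "A \<in> carrier SL2Z" "a = PSL_class A"
    using a unfolding carrier_PSL2Z by blast
  \<comment> \<open>Membership is carried along in the induction because multiplicativity of
    \<open>PSL_class\<close> requires it.\<close>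
  have "A \<in> carrier SL2Z \<and> P (PSL_class A)"
    using A(1)
  proof (rule SL2Z_induct)
    show "mat 1 \<in> carrier SL2Z \<and> P (PSL_class (mat 1))"
      using \<open>P \<one>\<^bsub>PSL2Z\<^esub>\<close> by (simp add: PSL_class_one SL2Z_simps)
    show "A ** S_mat \<in> carrier SL2Z \<and> P (PSL_class (A ** S_mat))"
      "A ** T_mat \<in> carrier SL2Z \<and> P (PSL_class (A ** T_mat))"
      if "A \<in> carrier SL2Z \<and> P (PSL_class A)" for A
      using that step[of "PSL_class A"] S_T_mat_SL2Z
      by (auto simp: PSL_class_mult) (auto simp: SL2Z_simps det_mul)
  qed
  then obtain h r where "h \<in> ?K" "r \<in> set Rep" "a = h \<otimes>\<^bsub>PSL2Z\<^esub> r"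
    unfolding P_def A(2) by blast
  then show thesis
    by (rule that)
qed

text \<open>For generation, decompose a in H as h r. Then r lies in H, the coset of the identity, so
  distinctness of cosets forces r to be the identity and a = h.\<close>

lemma stopped_correct:
  assumes inv: "invariant (Rep, Gen, i)" and stop: "stopped (Rep, Gen, i)"
  shows "\<forall>c\<in>rcosets\<^bsub>PSL2Z\<^esub> H. \<exists>d\<in>set Rep. d \<in> c" "generate PSL2Z (set Gen) = H"
proof -
  let ?K = "generate PSL2Z (set Gen)"
  have valid: "valid_lists H Rep Gen"
    using inv by (simp add: invariant_def)
  then have Rep: "set Rep \<subseteq> carrier PSL2Z" and Gen: "set Gen \<subseteq> H"
    and one: "\<one>\<^bsub>PSL2Z\<^esub> \<in> set Rep" and dist: "inj_on (\<lambda>d. H #>\<^bsub>PSL2Z\<^esub> d) (set Rep)"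
    by (auto simp: valid_lists_def distinct_map)
  have KH: "?K \<subseteq> H"
    using Gen subgroup_H by (rule PSL.generate_subgroup_incl)
  have HG: "H \<subseteq> carrier PSL2Z"
    by (rule subgroup.subset[OF subgroup_H])
  have coset: "H #>\<^bsub>PSL2Z\<^esub> (h \<otimes>\<^bsub>PSL2Z\<^esub> r) = H #>\<^bsub>PSL2Z\<^esub> r" if "h \<in> H" "r \<in> carrier PSL2Z" for h r
    using PSL.r_coset_eq_iff[OF subgroup_H, of "h \<otimes>\<^bsub>PSL2Z\<^esub> r" r] that HG by (auto simp: PSL.m_assoc subset_iff)
  show "\<forall>c\<in>rcosets\<^bsub>PSL2Z\<^esub> H. \<exists>d\<in>set Rep. d \<in> c"
  proof
    fix c assume "c \<in> rcosets\<^bsub>PSL2Z\<^esub> H"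
    then obtain a where a: "a \<in> carrier PSL2Z" "c = H #>\<^bsub>PSL2Z\<^esub> a"
      unfolding RCOSETS_def by blast
    obtain h r where hr: "h \<in> ?K" "r \<in> set Rep" "a = h \<otimes>\<^bsub>PSL2Z\<^esub> r"
      using stopped_decomposition[OF inv stop a(1)] by blast
    then have "c = H #>\<^bsub>PSL2Z\<^esub> r"
      using coset[of h r] KH Rep a(2) by blast
    then show "\<exists>d\<in>set Rep. d \<in> c"
      using hr(2) PSL.rcos_self[OF _ subgroup_H] Rep by blast
  qed
  show "?K = H"
  proof
    show "H \<subseteq> ?K"
    proof
      fix a assume a: "a \<in> H"
      then obtain h r where hr: "h \<in> ?K" "r \<in> set Rep" "a = h \<otimes>\<^bsub>PSL2Z\<^esub> r"
        using stopped_decomposition[OF inv stop] HG by blast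
      have "H #>\<^bsub>PSL2Z\<^esub> r = H #>\<^bsub>PSL2Z\<^esub> a"
        using coset[of h r] hr KH Rep by blast
      also have "\<dots> = H #>\<^bsub>PSL2Z\<^esub> \<one>\<^bsub>PSL2Z\<^esub>"
        using coset[OF a PSL.one_closed] a HG by (simp add: subset_iff)
      finally have "r = \<one>\<^bsub>PSL2Z\<^esub>"
        using inj_onD[OF dist] hr(2) one by blast
      then show "a \<in> ?K"
        using hr KH HG by (simp add: subset_iff)
    qed
  qed (rule KH)
qed

end

text \<open>Choosing one matrix for each value of h already meets every coset, since matrices with
  the same value differ by an element of G on the left.\<close>

lemma finite_rcosets_PSL2Z:
  fixes h :: "int^2^2 \<Rightarrow> 'b"
  assumes G: "subgroup G SL2Z" and fin: "finite (h ` carrier SL2Z)"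
    and h: "\<And>A B. A \<in> carrier SL2Z \<Longrightarrow> B \<in> carrier SL2Z \<Longrightarrow> h A = h B \<Longrightarrow> A \<otimes>\<^bsub>SL2Z\<^esub> inv\<^bsub>SL2Z\<^esub> B \<in> G"
  shows "finite (rcosets\<^bsub>PSL2Z\<^esub> (PSL_class ` G))"
proof -
  let ?H = "PSL_class ` G"
  have H: "subgroup ?H PSL2Z"
    by (rule group_hom.subgroup_img_is_subgroup[OF group_hom_PSL_class G])
  let ?f = "\<lambda>y. ?H #>\<^bsub>PSL2Z\<^esub> PSL_class (inv_into (carrier SL2Z) h y)"
  have "rcosets\<^bsub>PSL2Z\<^esub> ?H \<subseteq> ?f ` (h ` carrier SL2Z)"
  proof
    fix c assume "c \<in> rcosets\<^bsub>PSL2Z\<^esub> ?H"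
    then obtain A where A: "A \<in> carrier SL2Z" "c = ?H #>\<^bsub>PSL2Z\<^esub> PSL_class A"
      unfolding RCOSETS_def carrier_PSL2Z by blast
    define B where "B = inv_into (carrier SL2Z) h (h A)"
    have B: "B \<in> carrier SL2Z" "h B = h A"
      unfolding B_def using A(1) by (auto intro: inv_into_into f_inv_into_f)
    have "PSL_class (A ** inv\<^bsub>SL2Z\<^esub> B) \<in> ?H"
      using h[OF A(1) B(1)] B(2) by (simp add: SL2Z_simps)
    then have "PSL_class A \<otimes>\<^bsub>PSL2Z\<^esub> inv\<^bsub>PSL2Z\<^esub> PSL_class B \<in> ?H"
      using A(1) B(1) group.inv_closed[OF group_SL2Z B(1)] by (simp add: PSL_class_mult PSL_class_inv)
    then have "c = ?H #>\<^bsub>PSL2Z\<^esub> PSL_class B"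
      using PSL.r_coset_eq_iff[OF H] A B carrier_PSL2Z by blast
    then show "c \<in> ?f ` (h ` carrier SL2Z)"
      using A(1) unfolding B_def by blast
  qed
  then show ?thesis
    using fin finite_subset by blast
qed


theorem mainTheorem2:
  fixes X :: "'a::topological_space set" and p :: "'a \<Rightarrow> torus"
    and lift :: "(int^2^2) set \<Rightarrow> int^2^2"
  assumes "origami X p"
    and "\<And>a. a \<in> carrier PSL2Z \<Longrightarrow> lift a \<in> a"
  shows "(\<forall>n Rep Gen i. run lift (Gamma_O X p) n = (Rep, Gen, i) \<longrightarrow>
            (\<forall>j<length Rep. \<forall>k<length Rep. j \<noteq> k \<longrightarrow>
               Gamma_O_bar X p #>\<^bsub>PSL2Z\<^esub> (Rep ! j) \<noteq> Gamma_O_bar X p #>\<^bsub>PSL2Z\<^esub> (Rep ! k)))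
       \<and> (\<exists>n. stopped (run lift (Gamma_O X p) n))
       \<and> (\<forall>n Rep Gen i. run lift (Gamma_O X p) n = (Rep, Gen, i) \<and> stopped (Rep, Gen, i) \<longrightarrow>
            (\<forall>c \<in> rcosets\<^bsub>PSL2Z\<^esub> (Gamma_O_bar X p). \<exists>d \<in> set Rep. d \<in> c) \<and>
            generate PSL2Z (set Gen) = Gamma_O_bar X p)"
proof -
  have G: "subgroup (Gamma_O X p) SL2Z"
    using assms(1) by (rule subgroup_Gamma_O)
  interpret coset_enumeration lift "Gamma_O X p"
    using assms(2) G by (rule coset_enumeration.intro)
  obtain h :: "int^2^2 \<Rightarrow> 2 \<Rightarrow> ('a \<times> 'a) set" where h: "finite (h ` carrier SL2Z)"
    "\<And>A B. A \<in> carrier SL2Z \<Longrightarrow> B \<in> carrier SL2Z \<Longrightarrow> h A = h B \<Longrightarrow> A \<otimes>\<^bsub>SL2Z\<^esub> inv\<^bsub>SL2Z\<^esub> B \<in> Gamma_O X p"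
    by (rule Gamma_O_finite_index_invariant[OF assms(1)]) (rule that; assumption)
  have fin: "finite (rcosets\<^bsub>PSL2Z\<^esub> (PSL_class ` Gamma_O X p))"
    using G h by (rule finite_rcosets_PSL2Z)
  show ?thesis
    unfolding Gamma_O_bar_def
  proof (intro conjI allI impI)
    fix n Rep Gen i j k
    assume r: "run lift (Gamma_O X p) n = (Rep, Gen, i)" and jk: "j < length Rep" "k < length Rep" "j \<noteq> k"
    have "distinct (map (\<lambda>d. PSL_class ` Gamma_O X p #>\<^bsub>PSL2Z\<^esub> d) Rep)"
      using invariant_run[of n] by (simp add: r invariant_def valid_lists_def)
    then show "PSL_class ` Gamma_O X p #>\<^bsub>PSL2Z\<^esub> (Rep ! j) \<noteq> PSL_class ` Gamma_O X p #>\<^bsub>PSL2Z\<^esub> (Rep ! k)"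
      using jk by (simp add: distinct_conv_nth)
  next
    show "\<exists>n. stopped (run lift (Gamma_O X p) n)"
      using fin by (rule run_stops)
  next
    fix n Rep Gen i
    assume r: "run lift (Gamma_O X p) n = (Rep, Gen, i) \<and> stopped (Rep, Gen, i)"
    then have inv: "invariant (Rep, Gen, i)"
      using invariant_run[of n] by simp
    show "\<forall>c\<in>rcosets\<^bsub>PSL2Z\<^esub> (PSL_class ` Gamma_O X p). \<exists>d\<in>set Rep. d \<in> c"
      "generate PSL2Z (set Gen) = PSL_class ` Gamma_O X p"
      using stopped_correct[OF inv] r by blast+
  qed
qed

end
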